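(* Let $d,\gamma,\delta,a_1,a_2,b_1,b_2,c_1,c_2$ be positive constants and consider the problem $$ \begin{cases} d\Delta w+f\bigl(\tfrac{w_{+}}{\delta},\tfrac{w_{-}}{\gamma}\bigr)-\gamma g\bigl(\tfrac{w_{+}}{\delta},\tfrac{w_{-}}{\gamma}\bigr)=0 &\text{in }\Omega,\\ \partial_\nu w=0 &\text{on }\partial\Omega,\\ \displaystyle\int_\Omega f\bigl(\tfrac{w_{+}}{\delta},\tfrac{w_{-}}{\gamma}\bigr)=0. \end{cases} $$ Then the set of all solutions $w$ of this problem consists exactly of the three constant functions $w=\delta a_1/b_1$, $w=0$ and $w=-\gamma a_2/c_2$.
   Context: $\Omega\subset\mathbb{R}^N$ is a bounded domain with smooth boundary $\partial\Omega$ if $N\ge 2$, and a bounded open interval if $N=1$; $\nu$ is the outward unit normal and $\partial_\nu w=\nu\cdot\nabla w$. $f(u,v):=u(a_1-b_1u-c_1v)$ and $g(u,v):=v(a_2-b_2u-c_2v)$. $w_+:=\max\{w,0\}$ and $w_-:=-\min\{w,0\}\ge 0$. A solution means a weak solution of the Neumann problem (i.e. $w\in H^1(\Omega)$ with $d\int_\Omega\nabla w\cdot\nabla\varphi=\int_\Omega\{f(w_+/\delta,w_-/\gamma)-\gamma g(w_+/\delta,w_-/\gamma)\}\varphi$ for all $\varphi\in C^1(\overline\Omega)$) that also satisfies the integral constraint. *)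

theory Defs
  imports "HOL-Analysis.Analysis"
begin

primrec Ck :: "nat \<Rightarrow> (real^'n \<Rightarrow> real) \<Rightarrow> bool" where
  "Ck 0 h \<longleftrightarrow> continuous_on UNIV h"
| "Ck (Suc k) h \<longleftrightarrow>
     (\<forall>x. h differentiable (at x)) \<and>
     (\<forall>i. Ck k (\<lambda>x. frechet_derivative h (at x) (axis i 1)))"

definition smooth :: "(real^'n \<Rightarrow> real) \<Rightarrow> bool" where
  "smooth h \<longleftrightarrow> (\<forall>k. Ck k h)"

text \<open>Near each boundary point, the set is the strict epigraph, in some direction \<open>e\<close>, of a
  smooth function on the hyperplane orthogonal to \<open>e\<close>.  The function \<open>h\<close> is given on the whole
  space but only its values on that hyperplane are used.\<close>

definition smooth_boundary :: "(real^'n) set \<Rightarrow> bool" where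
  "smooth_boundary \<Omega> \<longleftrightarrow>
     (\<forall>p \<in> frontier \<Omega>. \<exists>r e h. r > 0 \<and> norm e = 1 \<and> smooth h \<and>
        \<Omega> \<inter> ball p r = {x \<in> ball p r. x \<bullet> e > h (x - (x \<bullet> e) *\<^sub>R e)})"

definition smooth_bounded_domain :: "(real^'n) set \<Rightarrow> bool" where
  "smooth_bounded_domain \<Omega> \<longleftrightarrow>
     open \<Omega> \<and> connected \<Omega> \<and> bounded \<Omega> \<and> \<Omega> \<noteq> {} \<and>
     (CARD('n) = 1 \<longrightarrow> (\<exists>l u. \<Omega> = box l u)) \<and>
     (CARD('n) \<ge> 2 \<longrightarrow> smooth_boundary \<Omega>)"

definition in_L2 :: "(real^'n) set \<Rightarrow> (real^'n \<Rightarrow> 'b::euclidean_space) \<Rightarrow> bool" where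
  "in_L2 \<Omega> w \<longleftrightarrow>
     w \<in> borel_measurable (lebesgue_on \<Omega>) \<and>
     integrable (lebesgue_on \<Omega>) (\<lambda>x. (norm (w x))\<^sup>2)"

definition test_function :: "(real^'n) set \<Rightarrow> (real^'n \<Rightarrow> real) \<Rightarrow> bool" where
  "test_function \<Omega> \<psi> \<longleftrightarrow>
     smooth \<psi> \<and> compact (closure {x. \<psi> x \<noteq> 0}) \<and> closure {x. \<psi> x \<noteq> 0} \<subseteq> \<Omega>"

definition has_weak_gradient ::
  "(real^'n) set \<Rightarrow> (real^'n \<Rightarrow> real) \<Rightarrow> (real^'n \<Rightarrow> real^'n) \<Rightarrow> bool" where
  "has_weak_gradient \<Omega> w W \<longleftrightarrow>
     (\<forall>\<psi> i. test_function \<Omega> \<psi> \<longrightarrow>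
        (LINT x|lebesgue_on \<Omega>. w x * frechet_derivative \<psi> (at x) (axis i 1)) =
        - (LINT x|lebesgue_on \<Omega>. W x $ i * \<psi> x))"

text \<open>\<open>w\<close> belongs to \<open>H\<^sup>1(\<Omega>)\<close> with weak gradient \<open>W\<close>.  Elements of \<open>H\<^sup>1(\<Omega>)\<close> are represented by
  functions on the whole space; only their values almost everywhere in \<open>\<Omega>\<close> matter.\<close>

definition H1_gradient ::
  "(real^'n) set \<Rightarrow> (real^'n \<Rightarrow> real) \<Rightarrow> (real^'n \<Rightarrow> real^'n) \<Rightarrow> bool" where
  "H1_gradient \<Omega> w W \<longleftrightarrow> in_L2 \<Omega> w \<and> in_L2 \<Omega> W \<and> has_weak_gradient \<Omega> w W"

text \<open>\<open>\<phi>\<close> belongs to \<open>C\<^sup>1\<close> of the closure of \<open>\<Omega>\<close>: it is differentiable in \<open>\<Omega>\<close>, and \<open>\<phi>\<close> and its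
  gradient \<open>\<Phi>\<close> are continuous up to the boundary.\<close>

definition C1_closure_gradient ::
  "(real^'n) set \<Rightarrow> (real^'n \<Rightarrow> real) \<Rightarrow> (real^'n \<Rightarrow> real^'n) \<Rightarrow> bool" where
  "C1_closure_gradient \<Omega> \<phi> \<Phi> \<longleftrightarrow>
     continuous_on (closure \<Omega>) \<phi> \<and> continuous_on (closure \<Omega>) \<Phi> \<and>
     (\<forall>x\<in>\<Omega>. (\<phi> has_derivative (\<lambda>v. \<Phi> x \<bullet> v)) (at x))"

definition f_react :: "real \<Rightarrow> real \<Rightarrow> real \<Rightarrow> real \<Rightarrow> real \<Rightarrow> real" where
  "f_react a1 b1 c1 u v = u * (a1 - b1 * u - c1 * v)"

definition g_react :: "real \<Rightarrow> real \<Rightarrow> real \<Rightarrow> real \<Rightarrow> real \<Rightarrow> real" where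
  "g_react a2 b2 c2 u v = v * (a2 - b2 * u - c2 * v)"

definition pos_part :: "real \<Rightarrow> real" where
  "pos_part t = max t 0"

definition neg_part :: "real \<Rightarrow> real" where
  "neg_part t = - min t 0"

text \<open>Weak formulation of \<open>d \<Delta>w + F(w) = 0\<close> in \<open>\<Omega>\<close> with the homogeneous Neumann condition, which is
  encoded by the test functions not vanishing on the boundary.  All the integrals below converge
  on a bounded \<open>\<Omega>\<close> when \<open>F\<close> is continuous with at most quadratic growth.\<close>

definition weak_neumann_solution ::
  "(real^'n) set \<Rightarrow> real \<Rightarrow> (real \<Rightarrow> real) \<Rightarrow> (real^'n \<Rightarrow> real) \<Rightarrow> bool" where
  "weak_neumann_solution \<Omega> d F w \<longleftrightarrow>
     (\<exists>W. H1_gradient \<Omega> w W \<and>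
        (\<forall>\<phi> \<Phi>. C1_closure_gradient \<Omega> \<phi> \<Phi> \<longrightarrow>
           d * (LINT x|lebesgue_on \<Omega>. W x \<bullet> \<Phi> x) =
           (LINT x|lebesgue_on \<Omega>. F (w x) * \<phi> x)))"

end

theory Submission
  imports Defs
begin

text \<open>The equation is tested with \<open>\<eta>(w)\<close>, where \<open>\<eta> = arctan\<close>; what matters about \<open>\<eta>\<close> is that it
  is bounded and has a continuous, bounded and positive derivative. Write \<open>f\<close>, \<open>g\<close> for the two reaction terms as functions
  of \<open>w\<close> and \<open>F = f - \<gamma> g\<close>. Formally,
  \<open>d \<integral> \<eta>'(w) |\<nabla>w|\<^sup>2 = \<integral> F(w) \<eta>(w)\<close>.
  The constraint is \<open>\<integral> f(w) = 0\<close>, and testing with the constant \<open>1\<close> gives \<open>\<integral> F(w) = 0\<close>, hence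
  \<open>\<integral> g(w) = 0\<close> as well. Constants may therefore be subtracted from \<open>\<eta>\<close> separately in the two terms:
  \<open>d \<integral> \<eta>'(w) |\<nabla>w|\<^sup>2 = \<integral> f(w) (\<eta>(w) - \<eta>(\<delta> a1 / b1)) - \<gamma> \<integral> g(w) (\<eta>(w) - \<eta>(- \<gamma> a2 / c2))\<close>.
  Now \<open>f\<close> lives on \<open>w > 0\<close>, is positive below \<open>\<delta> a1 / b1\<close> and negative above, and \<open>g\<close> lives on
  \<open>w < 0\<close>, is positive above \<open>- \<gamma> a2 / c2\<close> and negative below. By monotonicity of \<open>\<eta>\<close> the right-hand side
  is \<open>\<le> 0\<close> (\<open>f_react_sign\<close>, \<open>g_react_sign\<close>). So \<open>\<nabla>w = 0\<close>, \<open>w\<close> is a constant \<open>c\<close> because \<open>\<Omega>\<close> is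
  connected (\<open>zero_gradient_imp_constant\<close>), and the two integral identities become \<open>f(c) = g(c) = 0\<close>,
  which leaves the three values of the claim. Conversely, both reaction terms vanish at these values
  (\<open>reaction_at_equilibria\<close>), and constants have weak gradient zero because a derivative of a compactly
  supported function integrates to zero (\<open>integral_grad_compact_support\<close>).

  The work lies in the admissibility of \<open>\<eta>(w)\<close>: the test functions are \<open>C\<^sup>1\<close> up to the boundary,
  while \<open>w\<close> is only in \<open>H\<^sup>1\<close>. Near a point of the closure, \<open>w\<close> is approximated by convolutions with
  smooth kernels whose supports are shifted into \<open>\<Omega>\<close> along a direction in which \<open>\<Omega>\<close> contains a
  uniform cone (\<open>smooth_domain_local_cone\<close>). These approximations \<open>v\<^sub>n\<close> are \<open>C\<^sup>1\<close> on the whole space, and on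
  the part of \<open>\<Omega>\<close> near that point their gradients converge to \<open>\<nabla>w\<close> in \<open>L\<^sup>2\<close>
  (\<open>local_smooth_approximation\<close>). Testing with \<open>\<zeta> \<eta>(v\<^sub>n)\<close> for a cutoff \<open>\<zeta>\<close> and passing to the limit
  yields a localized identity (\<open>weak_equation_local_arctan\<close>) that contains the chain rule for
  \<open>\<eta>(w)\<close> implicitly; summing it over a partition of unity removes the cutoffs
  (\<open>weak_equation_arctan\<close>).\<close>

section \<open>Smooth bump functions\<close>

text \<open>The functions \<open>p(1/t) exp(-1/t)\<close> on \<open>t > 0\<close>, extended by \<open>0\<close>. Allowing a polynomial factor makes the
  family closed under differentiation, so that smoothness follows by induction on the order.\<close>

definition flat :: "real poly \<Rightarrow> real \<Rightarrow> real" where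
  "flat p t = (if t > 0 then poly p (1 / t) * exp (- (1 / t)) else 0)"

lemma flat_tendsto_0: "(flat p \<longlongrightarrow> 0) (at 0)"
proof -
  have "((\<lambda>x::real. \<Sum>i\<le>degree p. coeff p i * (x ^ i / exp x)) \<longlongrightarrow> (\<Sum>i\<le>degree p. coeff p i * 0)) at_top"
    by (intro tendsto_intros tendsto_power_div_exp_0)
  then have lim: "((\<lambda>x::real. poly p x * exp (- x)) \<longlongrightarrow> 0) at_top"
    by (simp add: poly_altdef sum_distrib_right exp_minus divide_inverse mult.assoc)
  have "((\<lambda>t. poly p (inverse t) * exp (- inverse t)) \<longlongrightarrow> 0) (at_right 0)"
    by (rule filterlim_compose[OF lim filterlim_inverse_at_top_right])
  then have r: "(flat p \<longlongrightarrow> 0) (at_right 0)"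
    by (rule Lim_transform_eventually)
      (auto simp: flat_def inverse_eq_divide eventually_at_filter)
  have l: "(flat p \<longlongrightarrow> 0) (at_left 0)"
    by (rule Lim_transform_eventually[OF tendsto_const])
      (auto simp: flat_def eventually_at_filter)
  show ?thesis
    using l r filterlim_split_at by blast
qed

text \<open>By the chain rule, \<open>p(1/t) exp(-1/t)\<close> has the derivative \<open>(p(1/t) - p'(1/t)) (1/t)\<^sup>2 exp(-1/t)\<close>. At \<open>0\<close>
  the difference quotient is the member of the family that belongs to the polynomial \<open>x p(x)\<close>, and
  every member tends to \<open>0\<close> there.\<close>

lemma flat_has_derivative:
  "(flat p has_real_derivative flat ([:0, 0, 1:] * (p - pderiv p)) t) (at t)"
proof -
  let ?q = "[:0, 0, 1:] * (p - pderiv p)"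
  consider "t > 0" | "t < 0" | "t = 0" by linarith
  then show ?thesis
  proof cases
    case 1
    have "((\<lambda>t. poly p (1 / t) * exp (- (1 / t))) has_real_derivative flat ?q t) (at t)"
      using 1 by (auto intro!: derivative_eq_intros simp: flat_def field_simps)
    then show ?thesis
      by (rule has_field_derivative_transform_within_open[where S="{0<..}"])
        (use 1 in \<open>auto simp: flat_def\<close>)
  next
    case 2
    have "((\<lambda>t. 0) has_real_derivative flat ?q t) (at t)"
      using 2 by (auto simp: flat_def)
    then show ?thesis
      by (rule has_field_derivative_transform_within_open[where S="{..<0}"])
        (use 2 in \<open>auto simp: flat_def\<close>)
  next
    case 3
    have "((\<lambda>h. (flat p (0 + h) - flat p 0) / h) \<longlongrightarrow> 0) (at 0)"
      by (rule Lim_transform_eventually[OF flat_tendsto_0[of "pCons 0 p"]])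
        (auto simp: flat_def eventually_at_filter)
    then show ?thesis
      using 3 by (simp add: DERIV_def flat_def)
  qed
qed

lemma Ck_Suc_I:
  fixes g :: "real^'n \<Rightarrow> real"
  assumes "\<And>x. (g has_derivative g' x) (at x)" "\<And>i. Ck k (\<lambda>x. g' x (axis i 1))"
  shows "Ck (Suc k) g"
proof -
  have "frechet_derivative g (at x) = g' x" for x
    using assms(1) frechet_derivative_at by metis
  then show ?thesis
    using assms by (auto simp: differentiable_def)
qed

lemma Ck_Suc_D:
  fixes g :: "real^'n \<Rightarrow> real"
  assumes "Ck (Suc k) g"
  shows "(g has_derivative frechet_derivative g (at x)) (at x)"
    and "Ck k (\<lambda>x. frechet_derivative g (at x) (axis i 1))"
  using assms by (auto simp: frechet_derivative_works)

lemma Ck_Suc_imp_Ck: "Ck (Suc k) g \<Longrightarrow> Ck k g"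
proof (induction k arbitrary: g)
  case 0
  then show ?case
    by (auto simp: continuous_on_eq_continuous_at differentiable_imp_continuous_within)
next
  case (Suc k)
  have "\<forall>x. g differentiable (at x)" "Ck k (\<lambda>x. frechet_derivative g (at x) (axis i 1))" for i
    using Suc.prems Suc.IH Ck_Suc_D(2)[OF Suc.prems] by auto
  then show ?case by simp
qed

lemma Ck_const: "Ck k (\<lambda>x. c)"
proof (induction k arbitrary: c)
  case (Suc k)
  show ?case
    by (rule Ck_Suc_I[where g'="\<lambda>x h. 0"]) (auto intro: Suc)
qed auto

lemma Ck_add: "Ck k g \<Longrightarrow> Ck k h \<Longrightarrow> Ck k (\<lambda>x. g x + h x)"
proof (induction k arbitrary: g h)
  case 0
  then show ?case by (auto intro: continuous_intros)
next
  case (Suc k)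
  show ?case
    by (rule Ck_Suc_I[OF has_derivative_add[OF Ck_Suc_D(1)[OF Suc.prems(1)] Ck_Suc_D(1)[OF Suc.prems(2)]]])
      (intro Suc.IH Ck_Suc_D(2) Suc.prems)
qed

lemma Ck_mult: "Ck k g \<Longrightarrow> Ck k h \<Longrightarrow> Ck k (\<lambda>x. g x * h x)"
proof (induction k arbitrary: g h)
  case 0
  then show ?case by (auto intro: continuous_intros)
next
  case (Suc k)
  show ?case
    by (rule Ck_Suc_I[OF has_derivative_mult[OF Ck_Suc_D(1)[OF Suc.prems(1)] Ck_Suc_D(1)[OF Suc.prems(2)]]])
      (intro Ck_add Suc.IH Ck_Suc_D(2) Suc.prems Ck_Suc_imp_Ck)
qed

lemma Ck_prod: "finite I \<Longrightarrow> (\<And>i. i \<in> I \<Longrightarrow> Ck k (g i)) \<Longrightarrow> Ck k (\<lambda>x. \<Prod>i\<in>I. g i x)"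
  by (induction I rule: finite_induct) (auto intro: Ck_const Ck_mult)

text \<open>Differentiation in the direction of coordinate \<open>i\<close> replaces \<open>p\<close> by another polynomial and multiplies by
  \<open>c\<close>; in the other directions it gives \<open>0\<close>. Hence the induction has to quantify over \<open>p\<close>.\<close>

lemma Ck_flat_coordinate: "Ck k (\<lambda>x::real^'n. flat p (c * x $ i + s))"
proof (induction k arbitrary: p)
  case 0
  have "continuous_on UNIV (flat p)"
    using DERIV_isCont[OF flat_has_derivative] continuous_at_imp_continuous_on by blast
  then show ?case
    by (auto intro!: continuous_intros continuous_on_compose2[of UNIV "flat p"])
next
  case (Suc k)
  let ?q = "[:0, 0, 1:] * (p - pderiv p)"
  have "((\<lambda>x. flat p (c * x $ i + s)) has_derivative
      (\<lambda>h. flat ?q (c * x $ i + s) * (c * h $ i))) (at x)" for x :: "real^'n"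
  proof -
    have "((\<lambda>x::real^'n. c * x $ i + s) has_derivative (\<lambda>h. c * h $ i)) (at x)"
      by (auto intro!: derivative_eq_intros bounded_linear_imp_has_derivative bounded_linear_vec_nth)
    then show ?thesis
      using has_derivative_compose[OF _ flat_has_derivative[unfolded has_field_derivative_def]]
      by blast
  qed
  then show ?case
    by (rule Ck_Suc_I) (intro Ck_mult Ck_const Suc.IH)
qed

definition bump :: "real^'n \<Rightarrow> real^'n \<Rightarrow> real^'n \<Rightarrow> real" where
  "bump l u x = (\<Prod>i\<in>UNIV. flat 1 (x $ i - l $ i) * flat 1 (u $ i - x $ i))"

lemma smooth_bump:
  fixes l u :: "real^'n"
  shows "smooth (bump l u)"
proof -
  have "Ck k (\<lambda>x::real^'n. flat 1 (1 * x $ i + (- l $ i)) * flat 1 ((-1) * x $ i + u $ i))" for k i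
    by (intro Ck_mult Ck_flat_coordinate)
  then have "Ck k (\<lambda>x::real^'n. \<Prod>i\<in>UNIV. flat 1 (1 * x $ i + (- l $ i)) * flat 1 ((-1) * x $ i + u $ i))" for k
    by (intro Ck_prod) auto
  then show ?thesis
    unfolding smooth_def bump_def[abs_def] by simp
qed

lemma bump_nonneg: "bump l u x \<ge> 0"
  unfolding bump_def by (intro prod_nonneg) (auto simp: flat_def)

lemma bump_neq_0_iff: "bump l u x \<noteq> 0 \<longleftrightarrow> x \<in> box l u"
  by (auto simp: bump_def flat_def mem_box_cart)

definition grad :: "(real^'n \<Rightarrow> real) \<Rightarrow> real^'n \<Rightarrow> real^'n" where
  "grad h x = (\<chi> i. frechet_derivative h (at x) (axis i 1))"

lemma smooth_has_grad:
  assumes "smooth h"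
  shows "(h has_derivative (\<lambda>v. grad h x \<bullet> v)) (at x)"
proof -
  have d: "(h has_derivative frechet_derivative h (at x)) (at x)"
    using assms Ck_Suc_D(1) unfolding smooth_def by blast
  have "frechet_derivative h (at x) = (\<lambda>v. grad h x \<bullet> v)"
  proof
    fix v
    interpret linear "frechet_derivative h (at x)"
      by (rule has_derivative_linear[OF d])
    have "frechet_derivative h (at x) v = frechet_derivative h (at x) (\<Sum>i\<in>UNIV. v $ i *\<^sub>R axis i 1)"
      using basis_expansion[of v] by (simp add: scalar_mult_eq_scaleR)
    also have "\<dots> = grad h x \<bullet> v"
      by (simp add: sum scale grad_def inner_vec_def mult.commute)
    finally show "frechet_derivative h (at x) v = grad h x \<bullet> v" .
  qed
  then show ?thesis using d by simp
qed

lemma smooth_continuous_grad: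
  assumes "smooth h"
  shows "continuous_on UNIV (grad h)"
proof -
  have "Ck 0 (\<lambda>x. frechet_derivative h (at x) (axis i 1))" for i
    using assms Ck_Suc_D(2) unfolding smooth_def by blast
  then show ?thesis
    unfolding grad_def[abs_def] by (intro continuous_on_vec_lambda) simp
qed

lemma smooth_continuous:
  assumes "smooth h"
  shows "continuous_on UNIV h"
  using assms unfolding smooth_def by (auto dest: spec[where x=0])

lemma grad_eqI:
  assumes "(h has_derivative (\<lambda>v. D \<bullet> v)) (at x)"
  shows "grad h x = D"
proof -
  have "frechet_derivative h (at x) = (\<lambda>v. D \<bullet> v)"
    using frechet_derivative_at[OF assms] by simp
  then show ?thesis
    by (simp add: grad_def vec_eq_iff inner_axis)
qed

lemma grad_eq_0_off_support:
  assumes "closed C" "\<And>y. y \<notin> C \<Longrightarrow> h y = 0" "x \<notin> C"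
  shows "grad h x = 0"
proof (rule grad_eqI)
  have "((\<lambda>x. 0) has_derivative (\<lambda>v. 0 \<bullet> v)) (at x)"
    by simp
  then show "(h has_derivative (\<bullet>) 0) (at x)"
    by (rule has_derivative_transform_within_open[where s="- C"])
      (use assms in \<open>auto simp: open_Compl\<close>)
qed

section \<open>Mollification in the space of square integrable functions\<close>

lemma compact_support_uniformly_continuous:
  fixes f :: "'a::euclidean_space \<Rightarrow> 'b::real_normed_vector"
  assumes cont: "continuous_on UNIV f" and supp: "\<And>x. norm x > R \<Longrightarrow> f x = 0" and "e > 0"
  obtains d where "d > 0" "\<And>x y. norm (x - y) < d \<Longrightarrow> norm (f x - f y) < e"
proof -
  have "uniformly_continuous_on (cball 0 (R + 1)) f"
    by (intro compact_uniformly_continuous compact_cball continuous_on_subset[OF cont]) auto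
  then obtain d where "d > 0" and d: "\<And>x y. x \<in> cball 0 (R + 1) \<Longrightarrow> y \<in> cball 0 (R + 1) \<Longrightarrow>
      dist y x < d \<Longrightarrow> dist (f y) (f x) < e"
    unfolding uniformly_continuous_on_def using \<open>e > 0\<close> by metis
  have "norm (f x - f y) < e" if "norm (x - y) < min d 1" for x y
  proof (cases "x \<in> cball 0 (R + 1) \<and> y \<in> cball 0 (R + 1)")
    case True
    then show ?thesis
      using d[of y x] that by (auto simp: dist_norm)
  next
    case False
    moreover have "norm x \<le> norm y + norm (x - y)" "norm y \<le> norm x + norm (x - y)"
      by norm+
    ultimately have "norm x > R \<and> norm y > R"
      using that by auto
    then show ?thesis
      using supp \<open>e > 0\<close> by simp
  qed
  then show ?thesis
    using that[of "min d 1"] \<open>d > 0\<close> by simp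
qed

lemma compact_support_bounded:
  fixes f :: "'a::euclidean_space \<Rightarrow> 'b::real_normed_vector"
  assumes cont: "continuous_on UNIV f" and supp: "\<And>x. norm x > R \<Longrightarrow> f x = 0"
  obtains B where "B > 0" "\<And>x. norm (f x) \<le> B"
proof -
  have "compact (f ` cball 0 R)"
    by (intro compact_continuous_image continuous_on_subset[OF cont]) auto
  then obtain B where "B > 0" and B: "\<And>x. x \<in> cball 0 R \<Longrightarrow> norm (f x) \<le> B"
    by (metis bounded_pos compact_imp_bounded imageI)
  then have "norm (f x) \<le> B" for x
    by (cases "norm x \<le> R") (auto simp: supp)
  then show ?thesis
    using that \<open>B > 0\<close> by blast
qed

lemma compact_support_integrable:
  fixes f :: "'a::euclidean_space \<Rightarrow> 'b::{second_countable_topology, banach}"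
  assumes cont: "continuous_on UNIV f" and supp: "\<And>x. norm x > R \<Longrightarrow> f x = 0"
  shows "integrable lborel f"
proof -
  have "integrable lborel (\<lambda>x. indicator (cball 0 R) x *\<^sub>R f x)"
    by (intro borel_integrable_compact continuous_on_subset[OF cont]) auto
  also have "(\<lambda>x. indicator (cball 0 R) x *\<^sub>R f x) = f"
    using supp by (auto simp: indicator_def fun_eq_iff not_le)
  finally show ?thesis .
qed

definition L2 :: "('a::euclidean_space \<Rightarrow> real) \<Rightarrow> bool" where
  "L2 g \<longleftrightarrow> g \<in> borel_measurable borel \<and> integrable lborel (\<lambda>x. (g x)\<^sup>2)"

lemma square_sum_le: "((a::real) + b)\<^sup>2 \<le> 2 * a\<^sup>2 + 2 * b\<^sup>2"
  using sum_squares_bound[of a b] by (simp add: power2_sum)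

lemma square_diff_le: "((a::real) - b)\<^sup>2 \<le> 2 * a\<^sup>2 + 2 * b\<^sup>2"
  using square_sum_le[of a "- b"] by simp

lemma abs_le_one_plus_square: "\<bar>t :: real\<bar> \<le> 1 + t\<^sup>2"
  using sum_squares_bound[of "\<bar>t\<bar>" 1] by simp

text \<open>The truncations are dominated by \<open>g\<close> and agree with \<open>g\<close> at each point from some index on.\<close>

lemma L2_truncation:
  fixes g :: "'a::euclidean_space \<Rightarrow> real"
  assumes "L2 g"
  defines "h \<equiv> \<lambda>(n::nat) x. if norm x \<le> real n then max (- real n) (min (real n) (g x)) else 0"
  shows "(\<lambda>n. LINT x|lborel. (g x - h n x)\<^sup>2) \<longlonglongrightarrow> 0"
proof -
  have [measurable]: "g \<in> borel_measurable borel" and g: "integrable lborel (\<lambda>x. (g x)\<^sup>2)"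
    using assms(1) by (auto simp: L2_def)
  have [measurable]: "h n \<in> borel_measurable borel" for n
    unfolding h_def by measurable
  have "(\<lambda>n. LINT x|lborel. (g x - h n x)\<^sup>2) \<longlonglongrightarrow> (LINT x::'a|lborel. (0 :: real))"
  proof (rule integral_dominated_convergence[OF _ _ g])
    show "AE x in lborel. (\<lambda>n. (g x - h n x)\<^sup>2) \<longlonglongrightarrow> 0"
    proof (rule AE_I2)
      fix x :: 'a
      obtain m :: nat where m: "max (norm x) \<bar>g x\<bar> \<le> real m"
        using real_arch_simple by blast
      have "(g x - h n x)\<^sup>2 = 0" if "n \<ge> m" for n
      proof -
        have "real m \<le> real n" using that by simp
        then show ?thesis using m by (auto simp: h_def)
      qed
      then show "(\<lambda>n. (g x - h n x)\<^sup>2) \<longlonglongrightarrow> 0"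
        by (intro tendsto_eventually) (auto simp: eventually_sequentially)
    qed
    show "AE x in lborel. norm ((g x - h n x)\<^sup>2) \<le> (g x)\<^sup>2" for n
    proof (rule AE_I2)
      fix x
      have "\<bar>g x - h n x\<bar> \<le> \<bar>g x\<bar>"
        by (auto simp: h_def)
      then show "norm ((g x - h n x)\<^sup>2) \<le> (g x)\<^sup>2"
        by (simp add: abs_le_square_iff)
    qed
  qed measurable
  then show ?thesis by simp
qed

text \<open>Truncation reduces the claim to a bounded function with bounded support. Such a function is an
  almost everywhere limit of continuous ones, and these may be clamped to the same bounds and cut off,
  after which dominated convergence applies.\<close>

lemma L2_approx_continuous:
  fixes g :: "'a::euclidean_space \<Rightarrow> real"
  assumes g: "L2 g" and "e > 0"
  obtains c R where "continuous_on UNIV c" "\<And>x. norm x > R \<Longrightarrow> c x = 0"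
    "integrable lborel (\<lambda>x. (g x - c x)\<^sup>2)" "(LINT x|lborel. (g x - c x)\<^sup>2) < e"
proof -
  define h where "h = (\<lambda>(n::nat) x. if norm x \<le> real n then max (- real n) (min (real n) (g x)) else 0)"
  have "(\<lambda>n. LINT x|lborel. (g x - h n x)\<^sup>2) \<longlonglongrightarrow> 0"
    using L2_truncation[OF g] unfolding h_def .
  then have "eventually (\<lambda>n. (LINT x|lborel. (g x - h n x)\<^sup>2) < e / 4) sequentially"
    by (rule order_tendstoD) (use \<open>e > 0\<close> in simp)
  then obtain n where n: "(LINT x|lborel. (g x - h n x)\<^sup>2) < e / 4"
    by (auto simp: eventually_sequentially)
  have [measurable]: "g \<in> borel_measurable borel" and g2: "integrable lborel (\<lambda>x. (g x)\<^sup>2)"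
    using g by (auto simp: L2_def)
  have [measurable]: "h n \<in> borel_measurable borel"
    unfolding h_def by measurable
  have hn: "\<bar>h n x\<bar> \<le> real n" "norm x > real n \<Longrightarrow> h n x = 0" for x
    by (auto simp: h_def)
  have "h n measurable_on UNIV"
    by (rule lebesgue_measurable_imp_measurable_on_real)
      (auto intro: measurable_completion)
  then obtain N f where N: "negligible N" and f: "\<And>k. continuous_on UNIV (f k)"
    and lim: "\<And>x. x \<notin> N \<Longrightarrow> (\<lambda>k. f k x) \<longlonglongrightarrow> h n x"
    unfolding measurable_on_def by auto
  \<comment> \<open>The first factor is a continuous cutoff, equal to \<open>1\<close> on the ball of radius \<open>n\<close>.\<close>
  define c where "c = (\<lambda>(k::nat) x. max 0 (min 1 (real n + 1 - norm x)) * max (- real n) (min (real n) (f k x)))"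
  have cc: "continuous_on UNIV (c k)" for k
    unfolding c_def by (intro continuous_intros f)
  have [measurable]: "c k \<in> borel_measurable borel" for k
    using cc by (rule borel_measurable_continuous_onI)
  have c0: "c k x = 0" if "norm x > real n + 1" for k x
    using that by (simp add: c_def)
  have cb: "\<bar>c k x\<bar> \<le> real n" for k x
  proof -
    have "\<bar>c k x\<bar> \<le> 1 * real n"
      unfolding c_def abs_mult by (intro mult_mono) auto
    then show ?thesis by simp
  qed
  have dom: "(h n x - c k x)\<^sup>2 \<le> indicator (cball 0 (real n + 1)) x * (2 * real n)\<^sup>2" for k x
  proof (cases "norm x \<le> real n + 1")
    case True
    have "\<bar>h n x - c k x\<bar> \<le> \<bar>2 * real n\<bar>"
      using hn(1)[of x] cb[of k x] by linarith
    then have "(h n x - c k x)\<^sup>2 \<le> (2 * real n)\<^sup>2"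
      by (simp only: abs_le_square_iff)
    then show ?thesis
      using True by simp
  next
    case False
    then show ?thesis using hn(2)[of x] c0[of x k] by simp
  qed
  have ind: "integrable lborel (\<lambda>x::'a. indicator (cball 0 (real n + 1)) x * (2 * real n)\<^sup>2)"
    using emeasure_bounded_finite[OF bounded_cball, of "0::'a" "real n + 1"]
    by (intro integrable_mult_left integrable_real_indicator) auto
  have "N \<in> null_sets (completion lborel)"
    using N by (simp add: negligible_iff_null_sets)
  then have AEN: "AE x in lborel. x \<notin> N"
    by (metis AE_completion_iff AE_not_in)
  have "(\<lambda>k. LINT x|lborel. (h n x - c k x)\<^sup>2) \<longlonglongrightarrow> (LINT x::'a|lborel. (0 :: real))"
  proof (rule integral_dominated_convergence[OF _ _ ind])
    show "AE x in lborel. (\<lambda>k. (h n x - c k x)\<^sup>2) \<longlonglongrightarrow> 0"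
      using AEN
    proof eventually_elim
      case (elim x)
      have "(\<lambda>k. c k x) \<longlonglongrightarrow> max 0 (min 1 (real n + 1 - norm x)) * max (- real n) (min (real n) (h n x))"
        unfolding c_def by (intro tendsto_intros lim elim)
      moreover have "max 0 (min 1 (real n + 1 - norm x)) * max (- real n) (min (real n) (h n x)) = h n x"
        using hn[of x] by (cases "norm x \<le> real n") (auto simp: max_def min_def)
      ultimately have "(\<lambda>k. c k x) \<longlonglongrightarrow> h n x"
        by simp
      then have "(\<lambda>k. (h n x - c k x)\<^sup>2) \<longlonglongrightarrow> (h n x - h n x)\<^sup>2"
        by (intro tendsto_intros)
      then show ?case by simp
    qed
    show "AE x in lborel. norm ((h n x - c k x)\<^sup>2) \<le> indicator (cball 0 (real n + 1)) x * (2 * real n)\<^sup>2" for k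
      using dom by simp
  qed measurable
  then have "eventually (\<lambda>k. (LINT x|lborel. (h n x - c k x)\<^sup>2) < e / 4) sequentially"
    by (rule order_tendstoD) (use \<open>e > 0\<close> in simp)
  then obtain k where k: "(LINT x|lborel. (h n x - c k x)\<^sup>2) < e / 4"
    by (auto simp: eventually_sequentially)
  have i1: "integrable lborel (\<lambda>x. (h n x - c k x)\<^sup>2)"
    by (rule Bochner_Integration.integrable_bound[OF ind]) (use dom[of _ k] in auto)
  have i2: "integrable lborel (\<lambda>x. (g x - h n x)\<^sup>2)"
  proof (rule Bochner_Integration.integrable_bound[OF g2])
    have "\<bar>g x - h n x\<bar> \<le> \<bar>g x\<bar>" for x
      by (auto simp: h_def)
    then show "AE x in lborel. norm ((g x - h n x)\<^sup>2) \<le> norm ((g x)\<^sup>2)"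
      by (simp add: abs_le_square_iff)
  qed measurable
  have i12: "integrable lborel (\<lambda>x. 2 * (g x - h n x)\<^sup>2 + 2 * (h n x - c k x)\<^sup>2)"
    using i1 i2 by auto
  have le: "(g x - c k x)\<^sup>2 \<le> 2 * (g x - h n x)\<^sup>2 + 2 * (h n x - c k x)\<^sup>2" for x
    using square_sum_le[of "g x - h n x" "h n x - c k x"] by simp
  have i3: "integrable lborel (\<lambda>x. (g x - c k x)\<^sup>2)"
    by (rule Bochner_Integration.integrable_bound[OF i12]) (use le in \<open>auto simp: abs_of_nonneg\<close>)
  have "(LINT x|lborel. (g x - c k x)\<^sup>2) \<le> (LINT x|lborel. 2 * (g x - h n x)\<^sup>2 + 2 * (h n x - c k x)\<^sup>2)"
    by (intro integral_mono i3 i12 le)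
  also have "\<dots> = 2 * (LINT x|lborel. (g x - h n x)\<^sup>2) + 2 * (LINT x|lborel. (h n x - c k x)\<^sup>2)"
    using i1 i2 by simp
  also have "\<dots> < e" using n k by simp
  finally show ?thesis
    using that[OF cc[of k] c0[of _ k] i3] by blast
qed

lemma nn_integral_lborel_translation:
  fixes h :: "'a::euclidean_space \<Rightarrow> ennreal"
  assumes [measurable]: "h \<in> borel_measurable borel"
  shows "(\<integral>\<^sup>+x. h (x + z) \<partial>lborel) = (\<integral>\<^sup>+x. h x \<partial>lborel)"
proof -
  have "(\<integral>\<^sup>+x. h x \<partial>lborel) = (\<integral>\<^sup>+x. h x \<partial>distr lborel borel ((+) z))"
    by (simp add: lborel_distr_plus)
  also have "\<dots> = (\<integral>\<^sup>+x. h (z + x) \<partial>lborel)"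
    by (subst nn_integral_distr) auto
  finally show ?thesis by (simp add: add.commute)
qed

lemma nn_integral_linear_combination:
  assumes [measurable]: "a \<in> borel_measurable M" "b \<in> borel_measurable M" "c \<in> borel_measurable M"
  shows "(\<integral>\<^sup>+x. r * a x + s * b x + t * c x \<partial>M)
    = r * (\<integral>\<^sup>+x. a x \<partial>M) + s * (\<integral>\<^sup>+x. b x \<partial>M) + t * (\<integral>\<^sup>+x. c x \<partial>M)"
  using assms by (simp add: nn_integral_add nn_integral_cmult)

text \<open>For a continuous function of compact support this is uniform continuity; the error of replacing \<open>g\<close> by
  such a function is the same before and after the translation.\<close>

lemma L2_translation_continuous:
  fixes g :: "'a::euclidean_space \<Rightarrow> real"
  assumes g: "L2 g" and "e > 0"
  obtains r where "r > 0"
    "\<And>z. norm z < r \<Longrightarrow> (\<integral>\<^sup>+x. ennreal ((g (x + z) - g x)\<^sup>2) \<partial>lborel) \<le> ennreal e"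
proof -
  obtain c R where c: "continuous_on UNIV c" and c0: "\<And>x. norm x > R \<Longrightarrow> c x = 0"
    and i: "integrable lborel (\<lambda>x. (g x - c x)\<^sup>2)" and ce: "(LINT x|lborel. (g x - c x)\<^sup>2) < e / 12"
    using L2_approx_continuous[OF g, of "e / 12"] \<open>e > 0\<close> by auto
  have [measurable]: "g \<in> borel_measurable borel"
    using g by (auto simp: L2_def)
  have [measurable]: "c \<in> borel_measurable borel"
    using c by (rule borel_measurable_continuous_onI)
  have nc: "(\<integral>\<^sup>+x. ennreal ((g x - c x)\<^sup>2) \<partial>lborel) \<le> ennreal (e / 12)"
    using ce by (subst nn_integral_eq_integral[OF i]) (auto intro!: ennreal_leI)
  \<comment> \<open>The summand \<open>1\<close> makes \<open>V\<close> positive also when the ball is empty.\<close>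
  define V where "V = measure lborel (cball (0::'a) (R + 1)) + 1"
  have "V > 0" unfolding V_def by (simp add: add_nonneg_pos)
  define s where "s = sqrt (e / (6 * V))"
  have s: "s > 0" "s\<^sup>2 = e / (6 * V)"
    using \<open>e > 0\<close> \<open>V > 0\<close> by (auto simp: s_def)
  obtain d where "d > 0" and d: "\<And>x y. norm (x - y) < d \<Longrightarrow> norm (c x - c y) < s"
    using compact_support_uniformly_continuous[OF c c0 \<open>s > 0\<close>] by blast
  have "(\<integral>\<^sup>+x. ennreal ((g (x + z) - g x)\<^sup>2) \<partial>lborel) \<le> ennreal e" if z: "norm z < min d 1" for z
  proof -
    let ?I = "indicator (cball (0::'a) (R + 1)) :: 'a \<Rightarrow> real"
    have cz: "(c (x + z) - c x)\<^sup>2 \<le> s\<^sup>2 * ?I x" for x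
    proof (cases "norm x \<le> R + 1")
      case True
      have "\<bar>c (x + z) - c x\<bar> \<le> \<bar>s\<bar>"
        using d[of "x + z" x] z s by simp
      then show ?thesis using True by (simp add: abs_le_square_iff)
    next
      case False
      moreover have "norm x \<le> norm (x + z) + norm z" by norm
      ultimately show ?thesis using z c0[of x] c0[of "x + z"] by simp
    qed
    have le: "(g (x + z) - g x)\<^sup>2 \<le> 4 * (g (x + z) - c (x + z))\<^sup>2 + 4 * (g x - c x)\<^sup>2 + 2 * (s\<^sup>2 * ?I x)" for x
    proof -
      have "(g (x + z) - g x)\<^sup>2 = (((g (x + z) - c (x + z)) - (g x - c x)) + (c (x + z) - c x))\<^sup>2"
        by (simp add: algebra_simps)
      also have "\<dots> \<le> 2 * ((g (x + z) - c (x + z)) - (g x - c x))\<^sup>2 + 2 * (c (x + z) - c x)\<^sup>2"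
        by (rule square_sum_le)
      finally show ?thesis
        using square_diff_le[of "g (x + z) - c (x + z)" "g x - c x"] cz[of x] by linarith
    qed
    have "(\<integral>\<^sup>+x. ennreal ((g (x + z) - g x)\<^sup>2) \<partial>lborel) \<le>
      (\<integral>\<^sup>+x. 4 * ennreal ((g (x + z) - c (x + z))\<^sup>2) + 4 * ennreal ((g x - c x)\<^sup>2) + ennreal (2 * s\<^sup>2) * ennreal (?I x) \<partial>lborel)"
    proof (rule nn_integral_mono)
      fix x
      have "ennreal ((g (x + z) - g x)\<^sup>2) \<le> ennreal (4 * (g (x + z) - c (x + z))\<^sup>2 + 4 * (g x - c x)\<^sup>2 + (2 * s\<^sup>2) * ?I x)"
        using le[of x] by (intro ennreal_leI) (simp add: mult.assoc)
      also have "\<dots> = 4 * ennreal ((g (x + z) - c (x + z))\<^sup>2) + 4 * ennreal ((g x - c x)\<^sup>2) + ennreal (2 * s\<^sup>2) * ennreal (?I x)"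
        by (simp add: ennreal_mult')
      finally show "ennreal ((g (x + z) - g x)\<^sup>2) \<le> \<dots>" .
    qed
    also have "\<dots> = 4 * (\<integral>\<^sup>+x. ennreal ((g (x + z) - c (x + z))\<^sup>2) \<partial>lborel) + 4 * (\<integral>\<^sup>+x. ennreal ((g x - c x)\<^sup>2) \<partial>lborel)
       + ennreal (2 * s\<^sup>2) * (\<integral>\<^sup>+x. ennreal (?I x) \<partial>lborel)"
    proof -
      have [measurable]: "cball (0::'a) (R + 1) \<in> sets borel"
        by simp
      have [measurable]: "(\<lambda>x. ennreal ((g (x + z) - c (x + z))\<^sup>2)) \<in> borel_measurable lborel"
        "(\<lambda>x. ennreal ((g x - c x)\<^sup>2)) \<in> borel_measurable lborel"
        "(\<lambda>x. ennreal (?I x)) \<in> borel_measurable lborel"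
        by measurable
      show ?thesis
        by (rule nn_integral_linear_combination) measurable
    qed
    also have "(\<integral>\<^sup>+x. ennreal ((g (x + z) - c (x + z))\<^sup>2) \<partial>lborel) = (\<integral>\<^sup>+x. ennreal ((g x - c x)\<^sup>2) \<partial>lborel)"
      by (rule nn_integral_lborel_translation[where h="\<lambda>x. ennreal ((g x - c x)\<^sup>2)"]) simp
    also have "(\<integral>\<^sup>+x. ennreal (?I x) \<partial>lborel) = ennreal (measure lborel (cball (0::'a) (R + 1)))"
      using emeasure_bounded_finite[OF bounded_cball, of "0::'a" "R + 1"]
      by (simp add: ennreal_indicator emeasure_eq_ennreal_measure)
    also have "\<dots> \<le> ennreal V"
      by (simp add: V_def)
    finally have "(\<integral>\<^sup>+x. ennreal ((g (x + z) - g x)\<^sup>2) \<partial>lborel) \<le>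
       4 * ennreal (e / 12) + 4 * ennreal (e / 12) + ennreal (2 * s\<^sup>2) * ennreal V"
      using nc by (meson add_mono dual_order.trans mult_left_mono order_refl zero_le)
    also have "\<dots> = ennreal (4 * (e / 12) + 4 * (e / 12) + 2 * s\<^sup>2 * V)"
    proof -
      have "4 * ennreal (e / 12) = ennreal (4 * (e / 12))"
        by (simp only: ennreal_mult'[of 4, simplified])
      moreover have "ennreal (2 * s\<^sup>2) * ennreal V = ennreal (2 * s\<^sup>2 * V)"
        by (rule ennreal_mult'[symmetric]) simp
      moreover have "4 * (e / 12) \<ge> 0" "2 * s\<^sup>2 * V \<ge> 0"
        using \<open>e > 0\<close> \<open>V > 0\<close> by auto
      ultimately show ?thesis
        by (simp only: ennreal_plus add_nonneg_nonneg)
    qed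
    also have "4 * (e / 12) + 4 * (e / 12) + 2 * s\<^sup>2 * V = e"
      using \<open>V > 0\<close> by (simp add: s(2))
    finally show ?thesis .
  qed
  then show ?thesis
    using that[of "min d 1"] \<open>d > 0\<close> by simp
qed

text \<open>Continuous probability densities concentrated near the origin. The kernels used near the boundary are
  supported on one side of it.\<close>

definition mollifier :: "real \<Rightarrow> ('a::euclidean_space \<Rightarrow> real) \<Rightarrow> bool" where
  "mollifier r k \<longleftrightarrow> continuous_on UNIV k \<and> (\<forall>x. k x \<ge> 0) \<and> (\<forall>x. norm x > r \<longrightarrow> k x = 0)
     \<and> (LINT x|lborel. k x) = 1"

text \<open>The convolution of \<open>g\<close> with the reflected kernel. In this form, \<open>mollify k g x\<close> averages \<open>g\<close> over
  \<open>x\<close> plus the support of \<open>k\<close>.\<close>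

definition mollify :: "('a::euclidean_space \<Rightarrow> real) \<Rightarrow> ('a \<Rightarrow> real) \<Rightarrow> 'a \<Rightarrow> real" where
  "mollify k g x = (LINT y|lborel. k (y - x) * g y)"

lemma mollify_shift:
  fixes g :: "'a::euclidean_space \<Rightarrow> real"
  assumes [measurable]: "g \<in> borel_measurable borel" "k \<in> borel_measurable borel"
  shows "mollify k g x = (LINT z|lborel. k z * g (x + z))"
proof -
  have "mollify k g x = (LINT y|distr lborel borel ((+) x). k (y - x) * g y)"
    by (simp add: lborel_distr_plus mollify_def)
  also have "\<dots> = (LINT z|lborel. k (x + z - x) * g (x + z))"
    by (rule integral_distr) auto
  finally show ?thesis by simp
qed

text \<open>Jensen's inequality for the square: the variance of \<open>h\<close> under the probability density \<open>k\<close> is nonnegative.\<close>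

lemma square_integral_le:
  fixes k h :: "'a \<Rightarrow> real"
  assumes k: "integrable M k" "(LINT x|M. k x) = 1" "\<And>x. k x \<ge> 0"
    and i: "integrable M (\<lambda>x. k x * h x)" "integrable M (\<lambda>x. k x * (h x)\<^sup>2)"
  shows "(LINT x|M. k x * h x)\<^sup>2 \<le> (LINT x|M. k x * (h x)\<^sup>2)"
proof -
  let ?m = "LINT x|M. k x * h x"
  have "0 \<le> (LINT x|M. k x * (h x - ?m)\<^sup>2)"
    using k(3) by (intro Bochner_Integration.integral_nonneg) simp
  also have "\<dots> = (LINT x|M. k x * (h x)\<^sup>2 - 2 * ?m * (k x * h x) + ?m\<^sup>2 * k x)"
    by (intro Bochner_Integration.integral_cong) (auto simp: power2_eq_square algebra_simps)
  also have "\<dots> = (LINT x|M. k x * (h x)\<^sup>2) - 2 * ?m * ?m + ?m\<^sup>2"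
    using k i by simp
  finally show ?thesis
    by (simp add: power2_eq_square)
qed

lemma L2_translation:
  assumes "L2 g"
  shows "integrable lborel (\<lambda>z. (g (x + z))\<^sup>2)"
proof -
  have [measurable]: "g \<in> borel_measurable borel" and g: "integrable lborel (\<lambda>x. (g x)\<^sup>2)"
    using assms by (auto simp: L2_def)
  have "integrable (distr lborel borel ((+) x)) (\<lambda>x. (g x)\<^sup>2)"
    using g by (simp add: lborel_distr_plus)
  then show ?thesis
    by (subst (asm) integrable_distr_eq) auto
qed

lemma mollifier_integrable_mult:
  assumes k: "mollifier r k" and h: "integrable lborel h"
  shows "integrable lborel (\<lambda>x. k x * h x)"
proof -
  have kc: "continuous_on UNIV k" and "\<And>x. norm x > r \<Longrightarrow> k x = 0"
    using k by (auto simp: mollifier_def)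
  then obtain B where B: "\<And>x. norm (k x) \<le> B"
    using compact_support_bounded by metis
  have [measurable]: "k \<in> borel_measurable borel"
    using kc by (rule borel_measurable_continuous_onI)
  have [measurable]: "h \<in> borel_measurable lborel"
    using h by simp
  show ?thesis
  proof (rule Bochner_Integration.integrable_bound)
    show "integrable lborel (\<lambda>x. B * norm (h x))"
      using h by simp
    show "AE x in lborel. norm (k x * h x) \<le> norm (B * norm (h x))"
      using order_trans[OF B abs_ge_self] by (auto simp: abs_mult intro!: mult_right_mono)
  qed measurable
qed

text \<open>Mollification averages translates of \<open>g\<close>. By Jensen's inequality and Tonelli's theorem its error in
  \<open>L\<^sup>2\<close> is therefore at most the largest translation error over the support of the kernel.\<close>

lemma mollify_L2_error:
  fixes g :: "'a::euclidean_space \<Rightarrow> real"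
  assumes k: "mollifier r k" and g: "L2 g"
    and e: "\<And>z. norm z \<le> r \<Longrightarrow> (\<integral>\<^sup>+x. ennreal ((g (x + z) - g x)\<^sup>2) \<partial>lborel) \<le> ennreal e"
  shows "(\<integral>\<^sup>+x. ennreal ((mollify k g x - g x)\<^sup>2) \<partial>lborel) \<le> ennreal e"
proof -
  have [measurable]: "g \<in> borel_measurable borel" and g2: "integrable lborel (\<lambda>x. (g x)\<^sup>2)"
    using g by (auto simp: L2_def)
  have kc: "continuous_on UNIV k" and k0: "\<And>x. norm x > r \<Longrightarrow> k x = 0" and kn: "\<And>x. k x \<ge> 0"
    and k1: "(LINT x|lborel. k x) = 1"
    using k by (auto simp: mollifier_def)
  have [measurable]: "k \<in> borel_measurable borel"
    using kc by (rule borel_measurable_continuous_onI)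
  have ki: "integrable lborel k"
    using compact_support_integrable[OF kc k0] by blast
  have jensen: "ennreal ((mollify k g x - g x)\<^sup>2) \<le> (\<integral>\<^sup>+z. ennreal (k z * (g (x + z) - g x)\<^sup>2) \<partial>lborel)" for x
  proof -
    have i1: "integrable lborel (\<lambda>z. k z * (g (x + z))\<^sup>2)"
      by (intro mollifier_integrable_mult[OF k] L2_translation[OF g])
    have i2: "integrable lborel (\<lambda>z. k z * (g x)\<^sup>2)"
      using ki by simp
    have i3: "integrable lborel (\<lambda>z. 2 * (k z * (g (x + z))\<^sup>2) + 2 * (k z * (g x)\<^sup>2))"
      using i1 i2 by simp
    have i4: "integrable lborel (\<lambda>z. k z * (g (x + z) - g x)\<^sup>2)"
    proof (rule Bochner_Integration.integrable_bound[OF i3])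
      have "k z * (g (x + z) - g x)\<^sup>2 \<le> k z * (2 * (g (x + z))\<^sup>2 + 2 * (g x)\<^sup>2)" for z
        by (intro mult_left_mono square_diff_le kn)
      then show "AE z in lborel. norm (k z * (g (x + z) - g x)\<^sup>2)
          \<le> norm (2 * (k z * (g (x + z))\<^sup>2) + 2 * (k z * (g x)\<^sup>2))"
        using kn by (auto simp: abs_of_nonneg algebra_simps)
    qed measurable
    have i5: "integrable lborel (\<lambda>z. k z * g (x + z))"
    proof (rule Bochner_Integration.integrable_bound)
      show "integrable lborel (\<lambda>z. k z * (g (x + z))\<^sup>2 + k z)"
        using i1 ki by simp
      have "k z * \<bar>g (x + z)\<bar> \<le> k z * ((g (x + z))\<^sup>2 + 1)" for z
      proof (rule mult_left_mono[OF _ kn])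
        show "\<bar>g (x + z)\<bar> \<le> (g (x + z))\<^sup>2 + 1"
          using abs_le_one_plus_square[of "g (x + z)"] by simp
      qed
      then show "AE z in lborel. norm (k z * g (x + z)) \<le> norm (k z * (g (x + z))\<^sup>2 + k z)"
        using kn by (auto simp: abs_mult abs_of_nonneg algebra_simps)
    qed measurable
    have i6: "integrable lborel (\<lambda>z. k z * (g (x + z) - g x))"
      using i5 ki by (simp add: algebra_simps)
    have "mollify k g x - g x = (LINT z|lborel. k z * g (x + z)) - (LINT z|lborel. k z * g x)"
      using k1 by (simp add: mollify_shift)
    also have "\<dots> = (LINT z|lborel. k z * (g (x + z) - g x))"
      using i5 ki by (simp add: algebra_simps)
    finally have "(mollify k g x - g x)\<^sup>2 \<le> (LINT z|lborel. k z * (g (x + z) - g x)\<^sup>2)"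
      using square_integral_le[OF ki k1 kn i6 i4] by simp
    then show ?thesis
      using kn by (subst nn_integral_eq_integral[OF i4]) (auto intro: ennreal_leI)
  qed
  have "(\<integral>\<^sup>+x. ennreal ((mollify k g x - g x)\<^sup>2) \<partial>lborel)
     \<le> (\<integral>\<^sup>+x. (\<integral>\<^sup>+z. ennreal (k z * (g (x + z) - g x)\<^sup>2) \<partial>lborel) \<partial>lborel)"
    by (rule nn_integral_mono) (rule jensen)
  also have "\<dots> = (\<integral>\<^sup>+z. (\<integral>\<^sup>+x. ennreal (k z * (g (x + z) - g x)\<^sup>2) \<partial>lborel) \<partial>lborel)"
    by (rule lborel_pair.Fubini') measurable
  also have "\<dots> = (\<integral>\<^sup>+z. ennreal (k z) * (\<integral>\<^sup>+x. ennreal ((g (x + z) - g x)\<^sup>2) \<partial>lborel) \<partial>lborel)"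
    by (simp add: ennreal_mult' kn nn_integral_cmult)
  also have "\<dots> \<le> (\<integral>\<^sup>+z. ennreal (k z) * ennreal e \<partial>lborel)"
  proof (rule nn_integral_mono)
    fix z
    show "ennreal (k z) * (\<integral>\<^sup>+x. ennreal ((g (x + z) - g x)\<^sup>2) \<partial>lborel) \<le> ennreal (k z) * ennreal e"
      using e[of z] k0[of z] by (cases "norm z \<le> r") (auto intro: mult_left_mono)
  qed
  also have "\<dots> = ennreal e"
    using nn_integral_eq_integral[OF ki] kn k1 by (simp add: nn_integral_multc)
  finally show ?thesis .
qed

text \<open>Differentiation under the integral. Since the gradient \<open>K\<close> of the kernel is uniformly continuous, the
  first-order Taylor remainder of \<open>k\<close> is small uniformly in the base point.\<close>

lemma mollify_has_derivative:
  fixes g :: "'a::euclidean_space \<Rightarrow> real"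
  assumes kd: "\<And>x. (k has_derivative (\<lambda>v. K x \<bullet> v)) (at x)" and Kc: "continuous_on UNIV K"
    and K0: "\<And>x. norm x > R \<Longrightarrow> K x = 0" and k0: "\<And>x. norm x > R \<Longrightarrow> k x = 0"
    and g: "integrable lborel g"
  defines "D \<equiv> \<lambda>x. - (LINT y|lborel. g y *\<^sub>R K (y - x))"
  shows "(mollify k g has_derivative (\<lambda>v. D x \<bullet> v)) (at x)" and "continuous_on UNIV D"
proof -
  have kc: "continuous_on UNIV k"
    using kd has_derivative_continuous continuous_at_imp_continuous_on by blast
  have [measurable]: "k \<in> borel_measurable borel" "K \<in> borel_measurable borel"
    using kc Kc by (auto intro: borel_measurable_continuous_onI)
  have [measurable]: "g \<in> borel_measurable borel"
    using borel_measurable_integrable[OF g] by simp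
  obtain B where B: "\<And>x. norm (k x) \<le> B"
    using compact_support_bounded[OF kc k0] by metis
  obtain C where C: "\<And>x. norm (K x) \<le> C"
    using compact_support_bounded[OF Kc K0] by metis
  have ik: "integrable lborel (\<lambda>y. k (y - x) * g y)" for x
  proof (rule Bochner_Integration.integrable_bound)
    show "integrable lborel (\<lambda>y. B * norm (g y))" using g by simp
    show "AE y in lborel. norm (k (y - x) * g y) \<le> norm (B * norm (g y))"
      using order_trans[OF B abs_ge_self] by (auto simp: abs_mult intro!: mult_right_mono)
  qed measurable
  have iK: "integrable lborel (\<lambda>y. g y *\<^sub>R K (y - x))" for x
  proof (rule Bochner_Integration.integrable_bound)
    show "integrable lborel (\<lambda>y. norm (g y) * C)" using g by simp
    show "AE y in lborel. norm (g y *\<^sub>R K (y - x)) \<le> norm (norm (g y) * C)"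
      using order_trans[OF C abs_ge_self] by (auto simp: abs_mult intro!: mult_left_mono)
  qed measurable
  define G where "G = (LINT y|lborel. \<bar>g y\<bar>) + 1"
  have Gp: "G > 0" "(LINT y|lborel. \<bar>g y\<bar>) \<le> G"
    using Bochner_Integration.integral_nonneg[of lborel "\<lambda>y. \<bar>g y\<bar>"] by (auto simp: G_def add_nonneg_pos)
  show "(mollify k g has_derivative (\<lambda>v. D x \<bullet> v)) (at x)"
    unfolding has_derivative_at_alt
  proof (intro conjI allI impI)
    show "bounded_linear (\<lambda>v. D x \<bullet> v)"
      by (rule bounded_linear_inner_right)
    fix e :: real assume "e > 0"
    then have "e / G > 0" using Gp by simp
    then obtain d where "d > 0" and d: "\<And>a b. norm (a - b) < d \<Longrightarrow> norm (K a - K b) < e / G"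
      using compact_support_uniformly_continuous[OF Kc K0] by blast
    have taylor: "\<bar>k b - k a - K a \<bullet> (b - a)\<bar> \<le> e / G * norm (b - a)" if "norm (b - a) < d" for a b
    proof -
      have "norm ((k b - K a \<bullet> b) - (k a - K a \<bullet> a)) \<le> e / G * norm (b - a)"
      proof (rule differentiable_bound)
        show "convex (ball a d)" by simp
        show "((\<lambda>z. k z - K a \<bullet> z) has_derivative (\<lambda>v. (K z - K a) \<bullet> v)) (at z within ball a d)" for z
          by (auto intro!: derivative_eq_intros has_derivative_at_withinI[OF kd] simp: inner_diff_left)
        show "onorm (\<lambda>v. (K z - K a) \<bullet> v) \<le> e / G" if "z \<in> ball a d" for z
        proof (rule onorm_le)
          fix v
          have "norm (K z - K a) \<le> e / G"
            using d[of z a] that by (simp add: dist_norm norm_minus_commute)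
          then show "norm ((K z - K a) \<bullet> v) \<le> e / G * norm v"
            using Cauchy_Schwarz_ineq2[of "K z - K a" v]
            by (smt (verit) mult_right_mono norm_ge_zero real_norm_def)
        qed
      qed (use that \<open>d > 0\<close> in \<open>auto simp: dist_norm norm_minus_commute\<close>)
      then show ?thesis by (simp add: inner_diff_right algebra_simps)
    qed
    have "norm (mollify k g x' - mollify k g x - D x \<bullet> (x' - x)) \<le> e * norm (x' - x)"
      if x': "norm (x' - x) < d" for x'
    proof -
      have iK': "integrable lborel (\<lambda>y. (g y *\<^sub>R K (y - x)) \<bullet> (x' - x))"
        by (rule integrable_inner_left) (rule iK)
      have "mollify k g x' - mollify k g x - D x \<bullet> (x' - x)
        = (LINT y|lborel. k (y - x') * g y) - (LINT y|lborel. k (y - x) * g y)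
          + (LINT y|lborel. (g y *\<^sub>R K (y - x)) \<bullet> (x' - x))"
        unfolding integral_inner_left[OF iK] D_def mollify_def by simp
      also have "\<dots> = (LINT y|lborel. k (y - x') * g y - k (y - x) * g y + (g y *\<^sub>R K (y - x)) \<bullet> (x' - x))"
        using ik iK' by simp
      finally have eq: "mollify k g x' - mollify k g x - D x \<bullet> (x' - x) = \<dots>" .
      have "norm (mollify k g x' - mollify k g x - D x \<bullet> (x' - x)) \<le> (LINT y|lborel. (e / G * norm (x' - x)) * \<bar>g y\<bar>)"
        unfolding eq
      proof (rule Bochner_Integration.integral_norm_bound_integral)
        show "norm (k (y - x') * g y - k (y - x) * g y + (g y *\<^sub>R K (y - x)) \<bullet> (x' - x))
          \<le> (e / G * norm (x' - x)) * \<bar>g y\<bar>" for y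
        proof -
          have "\<bar>k (y - x') - k (y - x) - K (y - x) \<bullet> ((y - x') - (y - x))\<bar> \<le> e / G * norm (x' - x)"
            using taylor[of "y - x'" "y - x"] x' by (simp add: norm_minus_commute)
          then have "\<bar>k (y - x') - k (y - x) - K (y - x) \<bullet> ((y - x') - (y - x))\<bar> * \<bar>g y\<bar> \<le> e / G * norm (x' - x) * \<bar>g y\<bar>"
            by (rule mult_right_mono) simp
          moreover have "(k (y - x') - k (y - x) - K (y - x) \<bullet> ((y - x') - (y - x))) * g y
            = k (y - x') * g y - k (y - x) * g y + (g y *\<^sub>R K (y - x)) \<bullet> (x' - x)"
            by (simp add: algebra_simps inner_diff_right)
          ultimately show ?thesis
            by (simp only: abs_mult[symmetric] real_norm_def)
        qed
      qed (use ik iK' g in auto)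
      also have "\<dots> = (e / G * norm (x' - x)) * (LINT y|lborel. \<bar>g y\<bar>)"
        by simp
      also have "\<dots> \<le> (e / G * norm (x' - x)) * G"
        using Gp \<open>e > 0\<close> by (intro mult_left_mono) auto
      also have "\<dots> = e * norm (x' - x)"
        using Gp by simp
      finally show ?thesis .
    qed
    then show "\<exists>d>0. \<forall>x'. norm (x' - x) < d \<longrightarrow>
        norm (mollify k g x' - mollify k g x - D x \<bullet> (x' - x)) \<le> e * norm (x' - x)"
      using \<open>d > 0\<close> by blast
  qed
  show "continuous_on UNIV D"
    unfolding continuous_on_iff
  proof (intro ballI allI impI)
    fix x :: 'a and e :: real assume "e > 0"
    then have "e / (2 * G) > 0" using Gp by simp
    then obtain d where "d > 0" and d: "\<And>a b. norm (a - b) < d \<Longrightarrow> norm (K a - K b) < e / (2 * G)"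
      using compact_support_uniformly_continuous[OF Kc K0] by blast
    have "dist (D x') (D x) < e" if "dist x' x < d" for x'
    proof -
      have "dist (D x') (D x) = norm (LINT y|lborel. g y *\<^sub>R K (y - x) - g y *\<^sub>R K (y - x'))"
        using iK by (simp add: D_def dist_norm)
      also have "\<dots> \<le> (LINT y|lborel. e / (2 * G) * \<bar>g y\<bar>)"
      proof (rule Bochner_Integration.integral_norm_bound_integral)
        show "norm (g y *\<^sub>R K (y - x) - g y *\<^sub>R K (y - x')) \<le> e / (2 * G) * \<bar>g y\<bar>" for y
        proof -
          have "norm (K (y - x) - K (y - x')) \<le> e / (2 * G)"
            using d[of "y - x" "y - x'"] that by (simp add: dist_norm)
          then have "\<bar>g y\<bar> * norm (K (y - x) - K (y - x')) \<le> \<bar>g y\<bar> * (e / (2 * G))"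
            by (rule mult_left_mono) simp
          then show ?thesis
            by (simp only: scaleR_diff_right[symmetric] norm_scaleR mult.commute)
        qed
      qed (use iK g in auto)
      also have "\<dots> = e / (2 * G) * (LINT y|lborel. \<bar>g y\<bar>)" by simp
      also have "\<dots> \<le> e / (2 * G) * G"
        using Gp \<open>e > 0\<close> by (intro mult_left_mono) auto
      also have "\<dots> < e" using Gp \<open>e > 0\<close> by simp
      finally show ?thesis .
    qed
    then show "\<exists>d>0. \<forall>x'\<in>UNIV. dist x' x < d \<longrightarrow> dist (D x') (D x) < e"
      using \<open>d > 0\<close> by blast
  qed
qed

lemma mollify_L2_tendsto:
  fixes g :: "'a::euclidean_space \<Rightarrow> real"
  assumes g: "L2 g" and k: "\<And>n. mollifier (r n) (k n)" and r: "r \<longlonglongrightarrow> 0"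
    and [measurable]: "\<And>n. mollify (k n) g \<in> borel_measurable borel"
  shows "integrable lborel (\<lambda>x. (mollify (k n) g x - g x)\<^sup>2)"
    and "(\<lambda>n. LINT x|lborel. (mollify (k n) g x - g x)\<^sup>2) \<longlonglongrightarrow> 0"
proof -
  have [measurable]: "g \<in> borel_measurable borel" and g2: "integrable lborel (\<lambda>x. (g x)\<^sup>2)"
    using g by (auto simp: L2_def)
  \<comment> \<open>A crude bound for all translations, which gives integrability of the error for every \<open>n\<close>.\<close>
  have tr: "(\<integral>\<^sup>+x. ennreal ((g (x + z) - g x)\<^sup>2) \<partial>lborel) \<le> ennreal (4 * (LINT x|lborel. (g x)\<^sup>2))" for z
  proof -
    have gz: "integrable lborel (\<lambda>x. (g (z + x))\<^sup>2)"
      by (rule L2_translation[OF g])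
    have "(\<integral>\<^sup>+x. ennreal ((g (x + z))\<^sup>2) \<partial>lborel) = (\<integral>\<^sup>+x. ennreal ((g x)\<^sup>2) \<partial>lborel)"
      by (rule nn_integral_lborel_translation[where h="\<lambda>x. ennreal ((g x)\<^sup>2)"]) simp
    then have eq: "(LINT x|lborel. (g (z + x))\<^sup>2) = (LINT x|lborel. (g x)\<^sup>2)"
      by (simp add: nn_integral_eq_integral[OF g2] nn_integral_eq_integral[OF gz] add.commute[of _ z])
    have "(\<integral>\<^sup>+x. ennreal ((g (x + z) - g x)\<^sup>2) \<partial>lborel) \<le> (\<integral>\<^sup>+x. ennreal (2 * (g (z + x))\<^sup>2 + 2 * (g x)\<^sup>2) \<partial>lborel)"
      by (intro nn_integral_mono ennreal_leI) (simp only: add.commute[of _ z] square_diff_le)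
    also have "\<dots> = ennreal (LINT x|lborel. 2 * (g (z + x))\<^sup>2 + 2 * (g x)\<^sup>2)"
      using gz g2 by (intro nn_integral_eq_integral) auto
    also have "(LINT x|lborel. 2 * (g (z + x))\<^sup>2 + 2 * (g x)\<^sup>2) = 4 * (LINT x|lborel. (g x)\<^sup>2)"
      using gz g2 eq by simp
    finally show ?thesis .
  qed
  have int: "integrable lborel (\<lambda>x. (mollify (k n) g x - g x)\<^sup>2)" for n
  proof (rule integrableI_bounded)
    have "(\<integral>\<^sup>+x. ennreal ((mollify (k n) g x - g x)\<^sup>2) \<partial>lborel) \<le> ennreal (4 * (LINT x|lborel. (g x)\<^sup>2))"
      by (rule mollify_L2_error[OF k g tr])
    also have "\<dots> < \<infinity>" by simp
    finally show "(\<integral>\<^sup>+x. ennreal (norm ((mollify (k n) g x - g x)\<^sup>2)) \<partial>lborel) < \<infinity>"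
      by simp
  qed measurable
  then show "integrable lborel (\<lambda>x. (mollify (k n) g x - g x)\<^sup>2)" .
  show "(\<lambda>n. LINT x|lborel. (mollify (k n) g x - g x)\<^sup>2) \<longlonglongrightarrow> 0"
    unfolding tendsto_iff
  proof (intro allI impI)
    fix e :: real assume "e > 0"
    then have "e / 2 > 0" by simp
    then obtain d where "d > 0" and d: "\<And>z. norm z < d \<Longrightarrow>
        (\<integral>\<^sup>+x. ennreal ((g (x + z) - g x)\<^sup>2) \<partial>lborel) \<le> ennreal (e / 2)"
      using L2_translation_continuous[OF g] by blast
    have "eventually (\<lambda>n. r n < d) sequentially"
      using r \<open>d > 0\<close> by (rule order_tendstoD)
    then show "eventually (\<lambda>n. dist (LINT x|lborel. (mollify (k n) g x - g x)\<^sup>2) 0 < e) sequentially"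
    proof eventually_elim
      case (elim n)
      have "(\<integral>\<^sup>+x. ennreal ((mollify (k n) g x - g x)\<^sup>2) \<partial>lborel) \<le> ennreal (e / 2)"
        using elim by (intro mollify_L2_error[OF k g] d) simp
      then have "(LINT x|lborel. (mollify (k n) g x - g x)\<^sup>2) \<le> e / 2"
        using \<open>e > 0\<close> by (simp add: nn_integral_eq_integral[OF int])
      moreover have "(LINT x|lborel. (mollify (k n) g x - g x)\<^sup>2) \<ge> 0"
        by simp
      ultimately show ?case
        using \<open>e > 0\<close> unfolding dist_real_def by linarith
    qed
  qed
qed

section \<open>Bump functions as kernels\<close>

definition unit_bump :: "real^'n \<Rightarrow> real^'n \<Rightarrow> real^'n \<Rightarrow> real" where
  "unit_bump l u x = bump l u x / (LINT y|lborel. bump l u y)"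

lemma bump_eq_0: "norm x > r \<Longrightarrow> cbox l u \<subseteq> cball 0 r \<Longrightarrow> bump l u x = 0"
  using bump_neq_0_iff[of l u x] box_subset_cbox[of l u] by auto

lemma bump_integral_pos:
  fixes l u :: "real^'n"
  assumes "box l u \<noteq> {}"
  shows "(LINT y|lborel. bump l u y) > 0"
proof -
  obtain r where r: "cbox l u \<subseteq> cball 0 r"
    using bounded_cbox[of l u] by (auto simp: bounded_iff subset_iff)
  have i: "integrable lborel (bump l u)"
    using compact_support_integrable[OF smooth_continuous[OF smooth_bump]] bump_eq_0[OF _ r] by blast
  have "(LINT y|lborel. bump l u y) \<noteq> 0"
  proof
    assume "(LINT y|lborel. bump l u y) = 0"
    then have "AE x in lborel. bump l u x = 0"
      using integral_nonneg_eq_0_iff_AE[OF i] bump_nonneg by auto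
    then have "AE x in lborel. x \<notin> box l u"
      by eventually_elim (use bump_neq_0_iff in blast)
    then have "box l u \<in> null_sets lborel"
      by (subst (asm) AE_iff_null_sets[symmetric]) auto
    then have "negligible (box l u)"
      by (simp add: negligible_iff_null_sets null_sets_completionI)
    then show False
      using open_not_negligible[OF open_box assms] by blast
  qed
  moreover have "(LINT y|lborel. bump l u y) \<ge> 0"
    by (intro Bochner_Integration.integral_nonneg bump_nonneg)
  ultimately show ?thesis by simp
qed

lemma smooth_unit_bump:
  fixes l u :: "real^'n"
  shows "smooth (unit_bump l u)"
proof -
  have "Ck k (\<lambda>x. bump l u x * inverse (LINT y|lborel. bump l u y))" for k
    using smooth_bump unfolding smooth_def by (intro Ck_mult Ck_const) blast
  then show ?thesis
    unfolding smooth_def unit_bump_def[abs_def] by (simp add: divide_inverse)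
qed

lemma mollifier_unit_bump:
  fixes l u :: "real^'n"
  assumes "box l u \<noteq> {}" "cbox l u \<subseteq> cball 0 r"
  shows "mollifier r (unit_bump l u)"
  unfolding mollifier_def
proof (intro conjI allI impI)
  show "continuous_on UNIV (unit_bump l u)"
    by (rule smooth_continuous[OF smooth_unit_bump])
  show "unit_bump l u x \<ge> 0" for x
    unfolding unit_bump_def using bump_nonneg bump_integral_pos[OF assms(1)] by (rule divide_nonneg_pos)
  show "unit_bump l u x = 0" if "norm x > r" for x
    using bump_eq_0[OF that assms(2)] by (simp add: unit_bump_def)
  show "(LINT x|lborel. unit_bump l u x) = 1"
    using bump_integral_pos[OF assms(1)] by (simp add: unit_bump_def)
qed

lemma grad_eq_0_outside_cbox:
  assumes "x \<notin> cbox l u"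
  shows "grad (unit_bump l u) x = 0"
proof (rule grad_eq_0_off_support[OF closed_cbox _ assms])
  show "unit_bump l u y = 0" if "y \<notin> cbox l u" for y
    using that bump_neq_0_iff[of l u y] box_subset_cbox[of l u] by (auto simp: unit_bump_def)
qed

text \<open>If \<open>x\<close> plus the support of the kernel lies in \<open>\<Omega>\<close>, the translated kernel may be used in the definition of the
  weak gradient.\<close>

lemma unit_bump_test_function:
  fixes l u x :: "real^'n"
  assumes "\<And>y. y \<in> cbox l u \<Longrightarrow> x + y \<in> \<Omega>"
  shows "test_function \<Omega> (\<lambda>y. unit_bump l u (y - x))"
    and "frechet_derivative (\<lambda>y. unit_bump l u (y - x)) (at y) (axis i 1) = grad (unit_bump l u) (y - x) $ i"
proof -
  have eq: "unit_bump l u (y - x) = bump (l + x) (u + x) y * inverse (LINT y|lborel. bump l u y)" for y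
    by (simp add: unit_bump_def bump_def divide_inverse algebra_simps)
  have "Ck k (\<lambda>y. bump (l + x) (u + x) y * inverse (LINT y|lborel. bump l u y))" for k
    using smooth_bump unfolding smooth_def by (intro Ck_mult Ck_const) blast
  then have s: "smooth (\<lambda>y. unit_bump l u (y - x))"
    unfolding smooth_def eq by blast
  have sub: "closure {y. unit_bump l u (y - x) \<noteq> 0} \<subseteq> cbox (l + x) (u + x)"
  proof (rule closure_minimal)
    show "{y. unit_bump l u (y - x) \<noteq> 0} \<subseteq> cbox (l + x) (u + x)"
      using bump_neq_0_iff box_subset_cbox[of "l + x" "u + x"] by (auto simp: eq)
  qed (rule closed_cbox)
  have "cbox (l + x) (u + x) \<subseteq> \<Omega>"
  proof
    fix y assume "y \<in> cbox (l + x) (u + x)"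
    then have "y - x \<in> cbox l u"
      by (auto simp: mem_box_cart algebra_simps)
    then show "y \<in> \<Omega>" using assms[of "y - x"] by simp
  qed
  moreover have "compact (closure {y. unit_bump l u (y - x) \<noteq> 0})"
    using sub bounded_subset[OF bounded_cbox sub] by (simp add: compact_eq_bounded_closed)
  ultimately show "test_function \<Omega> (\<lambda>y. unit_bump l u (y - x))"
    unfolding test_function_def using s sub by blast
  have "((\<lambda>y. unit_bump l u (y - x)) has_derivative (\<lambda>v. grad (unit_bump l u) (y - x) \<bullet> v)) (at y)"
  proof -
    have "((\<lambda>y. y - x) has_derivative (\<lambda>v. v)) (at y)"
      by (auto intro!: derivative_eq_intros)
    from has_derivative_compose[OF this smooth_has_grad[OF smooth_unit_bump]] show ?thesis .
  qed
  from grad_eqI[OF this]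
  show "frechet_derivative (\<lambda>y. unit_bump l u (y - x)) (at y) (axis i 1) = grad (unit_bump l u) (y - x) $ i"
    by (simp add: grad_def vec_eq_iff)
qed

section \<open>One-sided cones at the boundary\<close>

text \<open>Near \<open>p\<close>, the set contains translates of one fixed solid cone, namely the cone spanned by the unit ball around \<open>q\<close> and
  truncated at height \<open>s\<close>, with apex at any of its points. For \<open>q = 0\<close> the cone is a ball, the case of an interior point.\<close>

definition local_cone :: "'a::real_normed_vector set \<Rightarrow> 'a \<Rightarrow> bool" where
  "local_cone \<Omega> p \<longleftrightarrow> (\<exists>r>0. \<exists>s>0. \<exists>q. \<forall>x \<in> \<Omega> \<inter> ball p r. \<forall>t b.
     0 < t \<and> t < s \<and> norm b \<le> 1 \<longrightarrow> x + t *\<^sub>R (q + b) \<in> \<Omega>)"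

lemma local_coneI:
  assumes "r > 0" "s > 0"
    "\<And>x t b. x \<in> \<Omega> \<Longrightarrow> x \<in> ball p r \<Longrightarrow> 0 < t \<Longrightarrow> t < s \<Longrightarrow> norm b \<le> 1 \<Longrightarrow> x + t *\<^sub>R (q + b) \<in> \<Omega>"
  shows "local_cone \<Omega> p"
  unfolding local_cone_def using assms by (intro exI[of _ r] exI[of _ s] exI[of _ q] conjI) auto

text \<open>The cone points from \<open>p\<close> towards an inner ball: for \<open>x\<close> close to \<open>p\<close>, the point
  \<open>x + t (q + b)\<close> is a convex combination of \<open>x\<close> and of a point of that ball. This is what covers the boundary of
  an interval in dimension one.\<close>

lemma convex_local_cone:
  fixes \<Omega> :: "'a::real_normed_vector set"
  assumes "open \<Omega>" "convex \<Omega>" "\<Omega> \<noteq> {}"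
  shows "local_cone \<Omega> p"
proof -
  obtain c where "c \<in> \<Omega>" using assms by auto
  then obtain d where "d > 0" and d: "ball c d \<subseteq> \<Omega>"
    using assms(1) openE by blast
  \<comment> \<open>Half of the inner radius is spent on \<open>x - p\<close>, the other half on \<open>b\<close>.\<close>
  define r where "r = d / 2"
  have "r > 0" using \<open>d > 0\<close> by (simp add: r_def)
  have "x + t *\<^sub>R ((1 / r) *\<^sub>R (c - p) + b) \<in> \<Omega>"
    if x: "x \<in> \<Omega>" "x \<in> ball p r" and t: "0 < t" "t < r" and b: "norm b \<le> 1" for x t b
  proof -
    define y where "y = c + (x - p) + r *\<^sub>R b"
    have "norm ((x - p) + r *\<^sub>R b) \<le> norm (x - p) + r * norm b"
      using norm_triangle_ineq[of "x - p" "r *\<^sub>R b"] \<open>r > 0\<close> by simp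
    also have "\<dots> < r + r * 1"
      using x b \<open>r > 0\<close> by (intro add_less_le_mono mult_left_mono) (auto simp: dist_norm norm_minus_commute)
    finally have "norm (x - p + r *\<^sub>R b) < d" by (simp add: r_def)
    then have "y \<in> \<Omega>"
      using d unfolding y_def by (auto simp: subset_iff dist_norm norm_minus_commute algebra_simps)
    have "t / r > 0" "t / r < 1" using t \<open>r > 0\<close> by auto
    then have "(1 - t / r) *\<^sub>R x + (t / r) *\<^sub>R y \<in> \<Omega>"
      using x \<open>y \<in> \<Omega>\<close> by (intro convexD[OF assms(2)]) auto
    moreover have "(1 - t / r) *\<^sub>R x + (t / r) *\<^sub>R y = x + t *\<^sub>R ((1 / r) *\<^sub>R (c - p) + b)"
      using \<open>r > 0\<close> by (simp add: y_def algebra_simps)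
    ultimately show ?thesis by simp
  qed
  then show ?thesis using local_coneI[of r r] \<open>r > 0\<close> by blast
qed

lemma smooth_locally_Lipschitz:
  fixes h :: "real^'n \<Rightarrow> real"
  assumes "smooth h"
  obtains L where "L > 0" "\<And>x y. x \<in> cball a r \<Longrightarrow> y \<in> cball a r \<Longrightarrow> \<bar>h x - h y\<bar> \<le> L * norm (x - y)"
proof -
  have "compact (grad h ` cball a r)"
    by (intro compact_continuous_image continuous_on_subset[OF smooth_continuous_grad[OF assms]]) auto
  then obtain L where "L > 0" and L: "\<And>x. x \<in> cball a r \<Longrightarrow> norm (grad h x) \<le> L"
    by (metis bounded_pos compact_imp_bounded imageI)
  have "\<bar>h x - h y\<bar> \<le> L * norm (x - y)" if "x \<in> cball a r" "y \<in> cball a r" for x y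
  proof -
    have "norm (h x - h y) \<le> L * norm (x - y)"
    proof (rule differentiable_bound)
      show "convex (cball a r)" by simp
      show "(h has_derivative (\<lambda>v. grad h z \<bullet> v)) (at z within cball a r)" for z
        by (rule has_derivative_at_withinI[OF smooth_has_grad[OF assms]])
      show "onorm (\<lambda>v. grad h z \<bullet> v) \<le> L" if "z \<in> cball a r" for z
      proof (rule onorm_le)
        fix v
        have "norm (grad h z \<bullet> v) \<le> norm (grad h z) * norm v"
          using Cauchy_Schwarz_ineq2 by simp
        also have "\<dots> \<le> L * norm v"
          by (intro mult_right_mono L that) simp
        finally show "norm (grad h z \<bullet> v) \<le> L * norm v" .
      qed
    qed (use that in auto)
    then show ?thesis by simp
  qed
  then show ?thesis using that \<open>L > 0\<close> by blast
qed

text \<open>Let \<open>L\<close> be a local Lipschitz constant of \<open>h\<close>. A step \<open>t (M e + b)\<close> raises the height \<open>x \<bullet> e\<close> by at least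
  \<open>t (M - 1)\<close> and the value of \<open>h\<close> by at most \<open>t L\<close>, so \<open>M = L + 2\<close> keeps the point in the epigraph.\<close>

lemma epigraph_local_cone:
  fixes \<Omega> :: "(real^'n) set"
  assumes "R > 0" "norm e = 1" "smooth h"
    and eq: "\<Omega> \<inter> ball p R = {x \<in> ball p R. x \<bullet> e > h (x - (x \<bullet> e) *\<^sub>R e)}"
  shows "local_cone \<Omega> p"
proof -
  define P where "P = (\<lambda>x. x - (x \<bullet> e) *\<^sub>R e)"
  have ee: "e \<bullet> e = 1" using assms(2) by (simp add: dot_square_norm)
  have Pdiff: "P x - P y = P (x - y)" for x y
    by (simp add: P_def algebra_simps inner_diff_left)
  have Pnorm: "norm (P x) \<le> norm x" for x
  proof -
    have "(norm (P x))\<^sup>2 = (norm x)\<^sup>2 - (x \<bullet> e)\<^sup>2"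
      unfolding P_def power2_norm_eq_inner
      by (simp add: inner_diff_left inner_diff_right ee inner_commute power2_eq_square)
    then have "(norm (P x))\<^sup>2 \<le> (norm x)\<^sup>2" by simp
    then show ?thesis by (rule power2_le_imp_le) simp
  qed
  obtain L where "L > 0" and L: "\<And>x y. x \<in> cball (P p) R \<Longrightarrow> y \<in> cball (P p) R \<Longrightarrow> \<bar>h x - h y\<bar> \<le> L * norm (x - y)"
    using smooth_locally_Lipschitz[OF assms(3)] by blast
  define M where "M = L + 2"
  define s where "s = R / 2 / (M + 1)"
  have "M > 0" "s > 0" using \<open>L > 0\<close> \<open>R > 0\<close> by (auto simp: M_def s_def)
  have "x + t *\<^sub>R (M *\<^sub>R e + b) \<in> \<Omega>"
    if x: "x \<in> \<Omega>" "x \<in> ball p (R / 2)" and t: "0 < t" "t < s" and b: "norm b \<le> 1" for x t b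
  proof -
    define y where "y = x + t *\<^sub>R (M *\<^sub>R e + b)"
    have "norm (M *\<^sub>R e + b) \<le> M + 1"
      using norm_triangle_ineq[of "M *\<^sub>R e" b] b assms(2) \<open>M > 0\<close> by simp
    then have "norm (y - x) \<le> t * (M + 1)"
      using t by (simp add: y_def)
    also have "\<dots> < s * (M + 1)" using t \<open>M > 0\<close> by simp
    also have "\<dots> = R / 2"
    proof -
      have "M + 1 \<noteq> 0" using \<open>M > 0\<close> by simp
      then show ?thesis by (rule iffD1[OF nonzero_eq_divide_eq s_def])
    qed
    finally have "norm (y - x) < R / 2" .
    moreover have "dist p y \<le> dist p x + norm (y - x)"
      by (metis dist_commute dist_norm dist_triangle)
    ultimately have y: "y \<in> ball p R" using x by auto
    have x': "x \<in> ball p R" using x \<open>R > 0\<close> by auto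
    have in_ball: "P z \<in> cball (P p) R" if "z \<in> ball p R" for z
      using that Pnorm[of "p - z"] Pdiff[of p z] by (auto simp: dist_norm)
    have "P y - P x = t *\<^sub>R P b"
      unfolding Pdiff by (simp add: y_def P_def ee algebra_simps inner_add_left)
    then have "norm (P y - P x) \<le> t"
      using Pnorm[of b] b t by (simp add: mult_left_le)
    then have "L * norm (P y - P x) \<le> L * t"
      using \<open>L > 0\<close> by (intro mult_left_mono) auto
    then have "h (P y) \<le> h (P x) + L * t"
      using L[OF in_ball[OF y] in_ball[OF x']] by linarith
    also have "h (P x) < x \<bullet> e"
      using eq x x' unfolding P_def by blast
    also have "x \<bullet> e + L * t < y \<bullet> e"
    proof -
      have "\<bar>b \<bullet> e\<bar> \<le> 1"
        using Cauchy_Schwarz_ineq2[of b e] b assms(2) by simp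
      then have "t * (b \<bullet> e) \<ge> t * (- 1)"
        using t by (intro mult_left_mono) auto
      moreover have "y \<bullet> e = x \<bullet> e + t * L + t * 2 + t * (b \<bullet> e)"
        by (simp add: y_def M_def ee algebra_simps inner_add_left)
      ultimately show ?thesis using t by (simp add: mult.commute)
    qed
    finally have "y \<bullet> e > h (P y)" by simp
    then show ?thesis using y eq unfolding P_def y_def by blast
  qed
  then show ?thesis
    using \<open>R > 0\<close> \<open>s > 0\<close> by (intro local_coneI[of "R / 2" s]) simp_all
qed

lemma smooth_domain_local_cone:
  fixes \<Omega> :: "(real^'n) set"
  assumes \<Omega>: "smooth_bounded_domain \<Omega>" and p: "p \<in> closure \<Omega>"
  shows "local_cone \<Omega> p"
proof -
  have \<Omega>': "open \<Omega>" "\<Omega> \<noteq> {}"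
    using \<Omega> by (auto simp: smooth_bounded_domain_def)
  have "CARD('n) > 0" by simp
  then have "CARD('n) = 1 \<or> CARD('n) \<ge> 2" by linarith
  then consider "p \<in> \<Omega>" | "CARD('n) = 1" | "p \<in> frontier \<Omega>" "CARD('n) \<ge> 2"
    using p \<Omega>' by (auto simp: frontier_def interior_open)
  then show ?thesis
  proof cases
    case 1
    then obtain d where "d > 0" and d: "ball p d \<subseteq> \<Omega>"
      using \<Omega>' openE by blast
    have "x + t *\<^sub>R (0 + b) \<in> \<Omega>" if "x \<in> ball p (d / 2)" "0 < t" "t < d / 2" "norm b \<le> 1" for x t b
    proof -
      have "t * norm b \<le> t * 1" using that by (intro mult_left_mono) auto
      then have "norm (t *\<^sub>R b) \<le> t" using that by simp
      then have "norm (t *\<^sub>R b) < d / 2" using that by linarith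
      moreover have "dist p (x + t *\<^sub>R b) \<le> dist p x + norm (t *\<^sub>R b)"
        using dist_triangle[of p "x + t *\<^sub>R b" x] by (simp add: dist_norm)
      ultimately have "x + t *\<^sub>R b \<in> ball p d" using that by simp
      then show ?thesis using d by auto
    qed
    then show ?thesis using local_coneI[of "d / 2" "d / 2" \<Omega> p 0] \<open>d > 0\<close> by simp
  next
    case 2
    then obtain l u where "\<Omega> = box l u"
      using \<Omega> by (auto simp: smooth_bounded_domain_def)
    then have "convex \<Omega>" by (simp add: convex_box)
    from convex_local_cone[OF \<Omega>'(1) this \<Omega>'(2)] show ?thesis .
  next
    case 3
    then obtain R e h where "R > 0" "norm e = 1" "smooth h"
      "\<Omega> \<inter> ball p R = {x \<in> ball p R. x \<bullet> e > h (x - (x \<bullet> e) *\<^sub>R e)}"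
      using \<Omega> unfolding smooth_bounded_domain_def smooth_boundary_def by meson
    from epigraph_local_cone[OF this] show ?thesis .
  qed
qed

text \<open>Boxes of half-width \<open>t / N\<close> around \<open>t q\<close>, with \<open>N\<close> the dimension, lie in the truncated cone: their points are \<open>t (q + b)\<close>
  with \<open>b\<close> of norm at most one, by comparison with the \<open>l\<^sup>1\<close> norm.\<close>

lemma local_shifted_boxes:
  fixes \<Omega> :: "(real^'n) set"
  assumes "smooth_bounded_domain \<Omega>" and "p \<in> closure \<Omega>"
  shows "\<exists>r>0. \<exists>l u \<rho>. (\<forall>n::nat. box (l n) (u n) \<noteq> {} \<and> cbox (l n) (u n) \<subseteq> cball 0 (\<rho> n)) \<and> \<rho> \<longlonglongrightarrow> 0 \<and>
    (\<forall>x \<in> \<Omega> \<inter> ball p r. \<forall>n. \<forall>y \<in> cbox (l n) (u n). x + y \<in> \<Omega>)"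
proof -
  obtain r q s where "r > 0" "s > 0" and cone:
    "\<And>x t b. x \<in> \<Omega> \<Longrightarrow> x \<in> ball p r \<Longrightarrow> 0 < t \<Longrightarrow> t < s \<Longrightarrow> norm b \<le> 1 \<Longrightarrow> x + t *\<^sub>R (q + b) \<in> \<Omega>"
    using smooth_domain_local_cone[OF assms] unfolding local_cone_def by (metis IntI)
  \<comment> \<open>The offset \<open>2\<close> keeps every step strictly below the cone height \<open>s\<close>.\<close>
  define t where "t = (\<lambda>n::nat. s / real (n + 2))"
  have t: "t n > 0" "t n < s" for n
    using \<open>s > 0\<close> by (auto simp: t_def divide_less_eq)
  have t0: "t \<longlonglongrightarrow> 0"
    unfolding t_def by (rule LIMSEQ_ignore_initial_segment[where f="\<lambda>n. s / real n"]) (rule lim_const_over_n)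
  define c :: "real^'n" where "c = (\<chi> i. 1 / real CARD('n))"
  define l where "l = (\<lambda>n. t n *\<^sub>R (q - c))"
  define u where "u = (\<lambda>n. t n *\<^sub>R (q + c))"
  have C: "real CARD('n) > 0" by simp
  have rep: "\<exists>b. norm b \<le> 1 \<and> y = t n *\<^sub>R (q + b)" if "y \<in> cbox (l n) (u n)" for y n
  proof -
    define b where "b = (1 / t n) *\<^sub>R y - q"
    have y: "y = t n *\<^sub>R (q + b)"
      using t[of n] by (simp add: b_def)
    have "\<bar>b $ i\<bar> \<le> 1 / real CARD('n)" for i
    proof -
      have "t n * (q $ i - 1 / real CARD('n)) \<le> t n * (q $ i + b $ i)"
        "t n * (q $ i + b $ i) \<le> t n * (q $ i + 1 / real CARD('n))"
        using that unfolding y by (auto simp: mem_box_cart l_def u_def c_def)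
      then show ?thesis
        using t[of n] by (simp only: mult_le_cancel_left_pos)
    qed
    then have "(\<Sum>i\<in>UNIV. \<bar>b $ i\<bar>) \<le> (\<Sum>i\<in>(UNIV::'n set). 1 / real CARD('n))"
      by (intro sum_mono)
    then have "norm b \<le> 1"
      using norm_le_l1_cart[of b] C by simp
    then show ?thesis using y by blast
  qed
  show ?thesis
  proof (intro exI conjI allI ballI)
    show "r > 0" by fact
    show "box (l n) (u n) \<noteq> {}" for n
      using t[of n] C by (auto simp: l_def u_def c_def interval_ne_empty_cart)
    show "cbox (l n) (u n) \<subseteq> cball 0 (t n * (norm q + 1))" for n
    proof
      fix y assume "y \<in> cbox (l n) (u n)"
      then obtain b where b: "norm b \<le> 1" "y = t n *\<^sub>R (q + b)" using rep by blast
      have "norm (q + b) \<le> norm q + 1"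
        using norm_triangle_ineq[of q b] b by simp
      then show "y \<in> cball 0 (t n * (norm q + 1))"
        using b t[of n] by simp
    qed
    show "(\<lambda>n. t n * (norm q + 1)) \<longlonglongrightarrow> 0"
      using tendsto_mult_right[OF t0, of "norm q + 1"] by simp
    show "x + y \<in> \<Omega>" if "x \<in> \<Omega> \<inter> ball p r" "y \<in> cbox (l n) (u n)" for n x y
      using rep[OF that(2)] cone[OF _ _ t] that(1) by blast
  qed
qed

section \<open>Smooth approximation up to the boundary\<close>

lemma integrable_const_lebesgue_on:
  fixes \<Omega> :: "(real^'n) set" and k :: real
  assumes "open \<Omega>" "bounded \<Omega>"
  shows "integrable (lebesgue_on \<Omega>) (\<lambda>x. k)"
proof -
  have "\<Omega> \<in> lmeasurable" using assms by (simp add: lmeasurable_open)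
  then have "\<Omega> \<in> sets lebesgue" "integrable lebesgue (\<lambda>x. indicator \<Omega> x * k)"
    by (auto simp: fmeasurable_def intro!: integrable_mult_left integrable_real_indicator)
  then show ?thesis by (simp add: integrable_restrict_space)
qed

lemma borel_measurable_component:
  fixes f :: "'a \<Rightarrow> real^'n"
  assumes "f \<in> borel_measurable M"
  shows "(\<lambda>x. f x $ i) \<in> borel_measurable M"
  unfolding cart_eq_inner_axis by (rule borel_measurable_inner[OF assms borel_measurable_const])

text \<open>A function on \<open>\<Omega>\<close> is extended by zero and made Borel measurable, so that Tonelli's theorem for
  \<open>lborel\<close> applies to its mollifications.\<close>

lemma borel_representative:
  fixes u :: "real^'n \<Rightarrow> real"
  assumes \<Omega>: "open \<Omega>" and [measurable]: "u \<in> borel_measurable (lebesgue_on \<Omega>)"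
    and i: "integrable (lebesgue_on \<Omega>) (\<lambda>x. (u x)\<^sup>2)"
  obtains g where "L2 g" "AE x in lebesgue. g x = indicator \<Omega> x * u x"
proof -
  have S: "\<Omega> \<in> sets lebesgue" using \<Omega> by (simp add: lborelD)
  have m: "(\<lambda>x. indicator \<Omega> x * u x) \<in> borel_measurable lebesgue"
    using assms(2) S by (subst (asm) borel_measurable_restrict_space_iff) auto
  obtain g where g: "g \<in> borel_measurable lborel" and ae: "AE x in lborel. indicator \<Omega> x * u x = g x"
    using completion_ex_borel_measurable_real[OF m] by blast
  have [measurable]: "g \<in> borel_measurable borel" using g by simp
  have ae': "AE x in lebesgue. g x = indicator \<Omega> x * u x"
    using AE_completion[OF ae] by eventually_elim simp
  have "integrable lebesgue (\<lambda>x. indicator \<Omega> x *\<^sub>R (u x)\<^sup>2)"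
    using i S by (subst (asm) integrable_restrict_space) auto
  moreover have "(\<lambda>x. (g x)\<^sup>2) \<in> borel_measurable lebesgue"
    by (rule measurable_completion) simp
  ultimately have "integrable lebesgue (\<lambda>x. (g x)\<^sup>2)"
    by (rule integrable_cong_AE_imp) (use ae' in eventually_elim, auto simp: power_mult_distrib indicator_def)
  then have "integrable lborel (\<lambda>x. (g x)\<^sup>2)"
    by (subst (asm) integrable_completion) auto
  then show ?thesis
    using that[of g] ae' by (simp add: L2_def)
qed

lemma L2_bounded_support_integrable:
  fixes g u :: "real^'n \<Rightarrow> real"
  assumes "bounded \<Omega>" "L2 g" and ae: "AE x in lebesgue. g x = indicator \<Omega> x * u x"
  shows "integrable lborel g"
proof -
  have [measurable]: "g \<in> borel_measurable borel" and g2: "integrable lborel (\<lambda>x. (g x)\<^sup>2)"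
    using assms(2) by (auto simp: L2_def)
  obtain r where r: "\<Omega> \<subseteq> cball 0 r"
    using assms(1) by (auto simp: bounded_iff subset_iff)
  have ind: "integrable lborel (indicator (cball 0 r) :: real^'n \<Rightarrow> real)"
    using emeasure_bounded_finite[OF bounded_cball, of "0::real^'n" r]
    by (intro integrable_real_indicator) auto
  have "integrable lebesgue g"
  proof (rule Bochner_Integration.integrable_bound)
    have "integrable lborel (\<lambda>x. (g x)\<^sup>2 + indicator (cball 0 r) x)"
      using g2 ind by simp
    then show "integrable lebesgue (\<lambda>x. (g x)\<^sup>2 + indicator (cball 0 r) x)"
      by (subst integrable_completion) auto
    show "g \<in> borel_measurable lebesgue"
      by (rule measurable_completion) simp
    show "AE x in lebesgue. norm (g x) \<le> norm ((g x)\<^sup>2 + indicator (cball 0 r) x)"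
      using ae
    proof eventually_elim
      case (elim x)
      have "\<bar>g x\<bar> \<le> (g x)\<^sup>2 + 1"
        using abs_le_one_plus_square[of "g x"] by simp
      then show ?case
        using elim r by (cases "x \<in> \<Omega>") (auto simp: subset_iff)
    qed
  qed
  then show ?thesis
    by (subst (asm) integrable_completion) auto
qed

lemma integral_representative:
  fixes g u F :: "real^'n \<Rightarrow> real"
  assumes \<Omega>: "open \<Omega>" and u: "u \<in> borel_measurable (lebesgue_on \<Omega>)"
    and [measurable]: "g \<in> borel_measurable borel" "F \<in> borel_measurable borel"
    and ae: "AE x in lebesgue. g x = indicator \<Omega> x * u x"
  shows "(LINT x|lebesgue_on \<Omega>. u x * F x) = (LINT x|lborel. g x * F x)"
proof -
  have S: "\<Omega> \<in> sets lebesgue" using \<Omega> by (simp add: lborelD)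
  have m: "(\<lambda>x. indicator \<Omega> x * u x) \<in> borel_measurable lebesgue"
    using u S by (subst (asm) borel_measurable_restrict_space_iff) auto
  have F: "F \<in> borel_measurable lebesgue" "(\<lambda>x. g x * F x) \<in> borel_measurable lebesgue"
    by (rule measurable_completion, simp)+
  have "(LINT x|lebesgue_on \<Omega>. u x * F x) = (LINT x|lebesgue. indicator \<Omega> x * u x * F x)"
    using S by (subst integral_restrict_space) (auto simp: mult.assoc)
  also have "\<dots> = (LINT x|lebesgue. g x * F x)"
    using ae by (intro integral_cong_AE borel_measurable_times m F) auto
  also have "\<dots> = (LINT x|lborel. g x * F x)"
    by (rule integral_completion) simp
  finally show ?thesis .
qed

lemma lebesgue_on_dominated:
  fixes F H :: "real^'n \<Rightarrow> real"
  assumes \<Omega>: "open \<Omega>" and F: "integrable lborel F" "\<And>x. F x \<ge> 0"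
    and H: "H \<in> borel_measurable (lebesgue_on \<Omega>)" and ae: "AE x in lebesgue_on \<Omega>. 0 \<le> H x \<and> H x \<le> F x"
  shows "integrable (lebesgue_on \<Omega>) H" "(LINT x|lebesgue_on \<Omega>. H x) \<le> (LINT x|lborel. F x)"
proof -
  have S: "\<Omega> \<in> sets lebesgue" using \<Omega> by (simp add: lborelD)
  have FL: "integrable lebesgue F" "(LINT x|lebesgue. F x) = (LINT x|lborel. F x)"
    using F by (auto simp: integrable_completion integral_completion)
  have FS: "integrable lebesgue (\<lambda>x. indicator \<Omega> x *\<^sub>R F x)"
    by (rule integrable_mult_indicator[OF S FL(1)])
  then have FO: "integrable (lebesgue_on \<Omega>) F"
    using S by (subst integrable_restrict_space) auto
  show HI: "integrable (lebesgue_on \<Omega>) H"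
    by (rule Bochner_Integration.integrable_bound[OF FO H]) (use ae in eventually_elim, auto)
  have "(LINT x|lebesgue_on \<Omega>. H x) \<le> (LINT x|lebesgue_on \<Omega>. F x)"
    by (rule integral_mono_AE[OF HI FO]) (use ae in eventually_elim, auto)
  also have "\<dots> = (LINT x|lebesgue. indicator \<Omega> x *\<^sub>R F x)"
    using S by (subst integral_restrict_space) auto
  also have "\<dots> \<le> (LINT x|lebesgue. F x)"
    by (rule integral_mono[OF FS FL(1)]) (use F(2) in \<open>auto simp: indicator_def\<close>)
  finally show "(LINT x|lebesgue_on \<Omega>. H x) \<le> (LINT x|lborel. F x)"
    using FL by simp
qed

text \<open>The derivative of a mollification puts the gradient on the kernel; where the support of the translated kernel stays in
  \<open>\<Omega>\<close>, the definition of the weak gradient moves it back onto \<open>w\<close>.\<close>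

lemma mollify_weak_gradient:
  fixes w :: "real^'n \<Rightarrow> real"
  assumes \<Omega>: "open \<Omega>" and wg: "has_weak_gradient \<Omega> w W"
    and m: "w \<in> borel_measurable (lebesgue_on \<Omega>)" "(\<lambda>x. W x $ i) \<in> borel_measurable (lebesgue_on \<Omega>)"
    and [measurable]: "g \<in> borel_measurable borel" "G \<in> borel_measurable borel"
    and ae: "AE x in lebesgue. g x = indicator \<Omega> x * w x" "AE x in lebesgue. G x = indicator \<Omega> x * W x $ i"
    and int: "integrable lborel (\<lambda>y. g y *\<^sub>R grad (unit_bump l u) (y - x))"
    and sub: "\<And>y. y \<in> cbox l u \<Longrightarrow> x + y \<in> \<Omega>"
  shows "- (LINT y|lborel. g y *\<^sub>R grad (unit_bump l u) (y - x)) $ i = mollify (unit_bump l u) G x"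
proof -
  have [measurable]: "unit_bump l u \<in> borel_measurable borel" "grad (unit_bump l u) \<in> borel_measurable borel"
    by (rule borel_measurable_continuous_onI[OF smooth_continuous[OF smooth_unit_bump]]
        borel_measurable_continuous_onI[OF smooth_continuous_grad[OF smooth_unit_bump]])+
  have mk: "(\<lambda>y. unit_bump l u (y - x)) \<in> borel_measurable borel"
    by measurable
  have mK: "(\<lambda>y. grad (unit_bump l u) (y - x) $ i) \<in> borel_measurable borel"
    by (rule borel_measurable_component) measurable
  have "(LINT y|lborel. g y *\<^sub>R grad (unit_bump l u) (y - x)) $ i = (LINT y|lborel. (g y *\<^sub>R grad (unit_bump l u) (y - x)) $ i)"
    using integral_inner_left[OF int, of "axis i 1"] by (simp add: inner_axis)
  also have "\<dots> = (LINT y|lborel. g y * (grad (unit_bump l u) (y - x) $ i))"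
    by simp
  also have "\<dots> = (LINT y|lebesgue_on \<Omega>. w y * (grad (unit_bump l u) (y - x) $ i))"
    by (rule integral_representative[OF \<Omega> m(1) assms(5) mK ae(1), symmetric])
  also have "\<dots> = - (LINT y|lebesgue_on \<Omega>. W y $ i * unit_bump l u (y - x))"
    using wg[unfolded has_weak_gradient_def, rule_format, OF unit_bump_test_function(1)[OF sub], where i=i]
    by (simp only: unit_bump_test_function(2)[OF sub])
  also have "(LINT y|lebesgue_on \<Omega>. W y $ i * unit_bump l u (y - x)) = (LINT y|lborel. G y * unit_bump l u (y - x))"
    by (rule integral_representative[OF \<Omega> m(2) assms(6) mk ae(2)])
  finally show ?thesis
    by (simp add: mollify_def mult.commute)
qed

text \<open>Near \<open>p\<close>, the gradients of the mollifications of \<open>w\<close> are the mollifications of \<open>W\<close>, since the kernels are supported in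
  the boxes that point into \<open>\<Omega>\<close>. The values converge in \<open>L\<^sup>2\<close> on all of \<open>\<Omega>\<close>, because \<open>w\<close> is extended by zero; the gradients
  do so only near \<open>p\<close>. The last clause is for the proof that a function with vanishing weak gradient is
  constant: there the approximations themselves have vanishing gradient, not merely in the limit.\<close>

lemma local_smooth_approximation:
  fixes \<Omega> :: "(real^'n) set"
  assumes \<Omega>: "smooth_bounded_domain \<Omega>" and H1: "H1_gradient \<Omega> w W" and p: "p \<in> closure \<Omega>"
  shows "\<exists>r>0. \<exists>v V.
    (\<forall>n::nat. \<forall>x. (v n has_derivative (\<lambda>h. V n x \<bullet> h)) (at x)) \<and>
    (\<forall>n. continuous_on UNIV (V n)) \<and>
    (\<forall>n. integrable (lebesgue_on \<Omega>) (\<lambda>x. (v n x - w x)\<^sup>2)) \<and>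
    (\<lambda>n. LINT x|lebesgue_on \<Omega>. (v n x - w x)\<^sup>2) \<longlonglongrightarrow> 0 \<and>
    (\<forall>n. integrable (lebesgue_on \<Omega>) (\<lambda>x. indicator (ball p r) x * (norm (V n x - W x))\<^sup>2)) \<and>
    (\<lambda>n. LINT x|lebesgue_on \<Omega>. indicator (ball p r) x * (norm (V n x - W x))\<^sup>2) \<longlonglongrightarrow> 0 \<and>
    ((AE x in lebesgue_on \<Omega>. W x = 0) \<longrightarrow> (\<forall>n. \<forall>x \<in> \<Omega> \<inter> ball p r. V n x = 0))"
proof -
  have op: "open \<Omega>" and bd: "bounded \<Omega>"
    using \<Omega> by (auto simp: smooth_bounded_domain_def)
  have S: "\<Omega> \<in> sets lebesgue" using op by (simp add: lborelD)
  have [measurable]: "w \<in> borel_measurable (lebesgue_on \<Omega>)" "W \<in> borel_measurable (lebesgue_on \<Omega>)"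
    and w2: "integrable (lebesgue_on \<Omega>) (\<lambda>x. (w x)\<^sup>2)"
    and W2: "integrable (lebesgue_on \<Omega>) (\<lambda>x. (norm (W x))\<^sup>2)"
    and wg: "has_weak_gradient \<Omega> w W"
    using H1 by (auto simp: H1_gradient_def in_L2_def)
  have Wi[measurable]: "(\<lambda>x. W x $ i) \<in> borel_measurable (lebesgue_on \<Omega>)" for i
    by (rule borel_measurable_component) measurable
  have Wi2: "integrable (lebesgue_on \<Omega>) (\<lambda>x. (W x $ i)\<^sup>2)" for i
    by (rule Bochner_Integration.integrable_bound[OF W2])
      (auto intro!: AE_I2 power2_mono simp: abs_le_square_iff[symmetric] component_le_norm_cart)
  obtain g where g: "L2 g" and gae: "AE x in lebesgue. g x = indicator \<Omega> x * w x"
    using borel_representative[OF op _ w2] by auto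
  have "\<exists>G. L2 G \<and> (AE x in lebesgue. G x = indicator \<Omega> x * W x $ i)" for i
    by (rule borel_representative[OF op Wi[of i] Wi2[of i]]) blast
  then obtain G where G: "\<And>i. L2 (G i)" and Gae: "\<And>i. AE x in lebesgue. G i x = indicator \<Omega> x * W x $ i"
    using choice[of "\<lambda>i G. L2 G \<and> (AE x in lebesgue. G x = indicator \<Omega> x * W x $ i)"] by blast
  have gi: "integrable lborel g" and Gi: "\<And>i. integrable lborel (G i)"
    using L2_bounded_support_integrable[OF bd g gae] L2_bounded_support_integrable[OF bd G Gae] by auto
  have [measurable]: "g \<in> borel_measurable borel" "\<And>i. G i \<in> borel_measurable borel"
    using g G by (auto simp: L2_def)
  obtain r l u \<rho> where "r > 0" and box: "\<And>n::nat. box (l n) (u n) \<noteq> {}"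
    "\<And>n. cbox (l n) (u n) \<subseteq> cball 0 (\<rho> n)" and \<rho>: "\<rho> \<longlonglongrightarrow> 0"
    and sub: "\<And>n x y. x \<in> \<Omega> \<Longrightarrow> x \<in> ball p r \<Longrightarrow> y \<in> cbox (l n) (u n) \<Longrightarrow> x + y \<in> \<Omega>"
    using local_shifted_boxes[OF \<Omega> p] by blast
  define k where "k = (\<lambda>n. unit_bump (l n) (u n))"
  define V where "V = (\<lambda>n x. - (LINT y|lborel. g y *\<^sub>R grad (k n) (y - x)))"
  have mk: "mollifier (\<rho> n) (k n)" for n
    unfolding k_def by (rule mollifier_unit_bump[OF box])
  have kd: "(k n has_derivative (\<lambda>v. grad (k n) x \<bullet> v)) (at x)" for n x
    unfolding k_def by (rule smooth_has_grad[OF smooth_unit_bump])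
  have Kc: "continuous_on UNIV (grad (k n))" for n
    unfolding k_def by (rule smooth_continuous_grad[OF smooth_unit_bump])
  have K0: "norm x > \<rho> n \<Longrightarrow> grad (k n) x = 0" for n x
    unfolding k_def using box(2)[of n] by (intro grad_eq_0_outside_cbox) auto
  have k0: "norm x > \<rho> n \<Longrightarrow> k n x = 0" for n x
    using mk[of n] by (simp add: mollifier_def)
  note der = mollify_has_derivative[OF kd Kc K0 k0]
  have cont: "continuous_on UNIV (mollify (k n) f)" if "integrable lborel f" for n f
    using has_derivative_continuous[OF der(1)[OF _ _ that]] by (intro continuous_at_imp_continuous_on) auto
  have bm[measurable]: "mollify (k n) f \<in> borel_measurable borel" if "integrable lborel f" for n f
    using cont[OF that] by (rule borel_measurable_continuous_onI)
  have Vi: "V n x $ i = mollify (k n) (G i) x" if x: "x \<in> \<Omega>" "x \<in> ball p r" for n x i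
  proof -
    obtain C where C: "\<And>x. norm (grad (k n) x) \<le> C"
      using compact_support_bounded[OF Kc[of n] K0[of n]] by blast
    have [measurable]: "grad (k n) \<in> borel_measurable borel"
      using Kc by (rule borel_measurable_continuous_onI)
    have "integrable lborel (\<lambda>y. g y *\<^sub>R grad (k n) (y - x))"
    proof (rule Bochner_Integration.integrable_bound)
      show "integrable lborel (\<lambda>y. norm (g y) * C)" using gi by simp
      show "AE y in lborel. norm (g y *\<^sub>R grad (k n) (y - x)) \<le> norm (norm (g y) * C)"
        using order_trans[OF C abs_ge_self] by (auto simp: abs_mult intro!: mult_left_mono)
    qed measurable
    from mollify_weak_gradient[OF op wg _ Wi _ _ gae Gae this[unfolded k_def] sub[OF x]]
    show ?thesis
      unfolding V_def k_def by simp
  qed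
  have aew: "AE x in lebesgue_on \<Omega>. w x = g x"
    using S gae by (subst AE_restrict_space_iff) auto
  have aeW: "AE x in lebesgue_on \<Omega>. \<forall>i. W x $ i = G i x"
  proof -
    have "AE x in lebesgue. \<forall>i. G i x = indicator \<Omega> x * W x $ i"
      using Gae by (simp add: AE_all_countable)
    then show ?thesis
      using S by (subst AE_restrict_space_iff) auto
  qed
  have vm[measurable]: "mollify (k n) f \<in> borel_measurable (lebesgue_on \<Omega>)" if "integrable lborel f" for n f
    using bm[OF that] by (intro measurable_restrict_space1 measurable_completion) simp
  have Vm[measurable]: "V n \<in> borel_measurable (lebesgue_on \<Omega>)" for n
  proof -
    have "V n \<in> borel_measurable borel"
      unfolding V_def by (rule borel_measurable_continuous_onI[OF der(2)[OF _ _ gi]])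
    then show ?thesis
      by (intro measurable_restrict_space1 measurable_completion) simp
  qed
  note vt = mollify_L2_tendsto[OF g mk \<rho> bm[OF gi]]
  note Vt = mollify_L2_tendsto[OF G mk \<rho> bm[OF Gi]]
  have wm: "(\<lambda>x. (mollify (k n) g x - w x)\<^sup>2) \<in> borel_measurable (lebesgue_on \<Omega>)" for n
    using vm[OF gi] by measurable
  have wdom: "AE x in lebesgue_on \<Omega>. 0 \<le> (mollify (k n) g x - w x)\<^sup>2 \<and> (mollify (k n) g x - w x)\<^sup>2 \<le> (mollify (k n) g x - g x)\<^sup>2" for n
    using aew by eventually_elim simp
  note wres = lebesgue_on_dominated[OF op vt(1) _ wm wdom, simplified]
  have [measurable]: "(indicator (ball p r) :: real^'n \<Rightarrow> real) \<in> borel_measurable (lebesgue_on \<Omega>)"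
    by (intro measurable_restrict_space1 measurable_completion borel_measurable_indicator) simp
  have Wm: "(\<lambda>x. indicator (ball p r) x * (norm (V n x - W x))\<^sup>2) \<in> borel_measurable (lebesgue_on \<Omega>)" for n
    by measurable
  let ?E = "\<lambda>n x. \<Sum>i\<in>UNIV. (mollify (k n) (G i) x - G i x)\<^sup>2"
  have Wdom: "AE x in lebesgue_on \<Omega>. 0 \<le> indicator (ball p r) x * (norm (V n x - W x))\<^sup>2 \<and>
      indicator (ball p r) x * (norm (V n x - W x))\<^sup>2 \<le> ?E n x" for n
    using aeW AE_space
  proof eventually_elim
    case (elim x)
    have E: "?E n x \<ge> 0" by (intro sum_nonneg) simp
    show ?case
    proof (cases "x \<in> ball p r")
      case True
      have "(norm (V n x - W x))\<^sup>2 = (\<Sum>i\<in>UNIV. (V n x $ i - W x $ i)\<^sup>2)"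
        by (simp add: norm_vec_def L2_set_def sum_nonneg)
      also have "\<dots> = ?E n x"
        using elim True Vi[of x] by (intro sum.cong) simp_all
      finally have "indicator (ball p r) x * (norm (V n x - W x))\<^sup>2 = ?E n x"
        using True by simp
      then show ?thesis using E by (simp only: order_refl)
    next
      case False
      then have "indicator (ball p r) x * (norm (V n x - W x))\<^sup>2 = 0"
        by simp
      then show ?thesis using E by (simp only: order_refl)
    qed
  qed
  have Ei: "integrable lborel (?E n)" for n
    using Vt(1) by simp
  have E0: "?E n x \<ge> 0" for n x by (intro sum_nonneg) simp
  note Wres = lebesgue_on_dominated[OF op Ei E0 Wm Wdom]
  have Elim: "(\<lambda>n. LINT x|lborel. ?E n x) \<longlonglongrightarrow> 0"
  proof -
    have "(\<lambda>n. \<Sum>i\<in>UNIV. LINT x|lborel. (mollify (k n) (G i) x - G i x)\<^sup>2) \<longlonglongrightarrow> (\<Sum>i\<in>(UNIV::'n set). 0)"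
      by (intro tendsto_sum Vt(2))
    then show ?thesis using Vt(1) by simp
  qed
  show ?thesis
  proof (intro exI[of _ r] exI[of _ "\<lambda>n. mollify (k n) g"] exI[of _ V] conjI allI impI ballI)
    show "r > 0" by fact
    show "(mollify (k n) g has_derivative (\<lambda>h. V n x \<bullet> h)) (at x)" for n x
      unfolding V_def by (rule der(1)[OF _ _ gi])
    show "continuous_on UNIV (V n)" for n
      unfolding V_def by (rule der(2)[OF _ _ gi])
    show "integrable (lebesgue_on \<Omega>) (\<lambda>x. (mollify (k n) g x - w x)\<^sup>2)" for n
      by (rule wres(1))
    show "(\<lambda>n. LINT x|lebesgue_on \<Omega>. (mollify (k n) g x - w x)\<^sup>2) \<longlonglongrightarrow> 0"
      by (rule tendsto_sandwich[OF _ _ tendsto_const vt(2)]) (use wres(2) in auto)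
    show "integrable (lebesgue_on \<Omega>) (\<lambda>x. indicator (ball p r) x * (norm (V n x - W x))\<^sup>2)" for n
      by (rule Wres(1))
    show "(\<lambda>n. LINT x|lebesgue_on \<Omega>. indicator (ball p r) x * (norm (V n x - W x))\<^sup>2) \<longlonglongrightarrow> 0"
      by (rule tendsto_sandwich[OF _ _ tendsto_const Elim]) (use Wres(2) in auto)
    show "V n x = 0" if W0: "AE x in lebesgue_on \<Omega>. W x = 0" and "x \<in> \<Omega> \<inter> ball p r" for n x
    proof -
      have x: "x \<in> \<Omega>" "x \<in> ball p r" using that(2) by auto
      have "mollify (k n) (G i) x = 0" for i
      proof -
        have "AE y in lebesgue. y \<in> \<Omega> \<longrightarrow> W y = 0"
          using W0 S by (subst (asm) AE_restrict_space_iff) auto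
        with Gae[of i] have "AE y in lebesgue. G i y = 0"
          by eventually_elim (auto simp: indicator_def)
        then have "AE y in lborel. G i y = 0"
          by (simp add: AE_completion_iff)
        then have "AE y in lborel. k n (y - x) * G i y = 0"
          by eventually_elim simp
        then show ?thesis
          unfolding mollify_def by (rule integral_eq_zero_AE)
      qed
      then show ?thesis
        using Vi[OF x] by (simp add: vec_eq_iff)
    qed
  qed
qed

section \<open>Testing the equation with a function of the solution\<close>

text \<open>Young's inequality \<open>|X Y| \<le> s X\<^sup>2 + Y\<^sup>2 / s\<close> with a small parameter \<open>s\<close>.\<close>

lemma L2_product_tendsto_0:
  fixes C :: "nat \<Rightarrow> 'a \<Rightarrow> real"
  assumes X: "integrable M (\<lambda>x. (X x)\<^sup>2)" and Y: "\<And>n. integrable M (\<lambda>x. (Y n x)\<^sup>2)"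
    and lim: "(\<lambda>n. LINT x|M. (Y n x)\<^sup>2) \<longlonglongrightarrow> 0"
    and m: "\<And>n. C n \<in> borel_measurable M" and le: "\<And>n x. x \<in> space M \<Longrightarrow> \<bar>C n x\<bar> \<le> \<bar>X x\<bar> * \<bar>Y n x\<bar>"
  shows "integrable M (C n)" and "(\<lambda>n. LINT x|M. C n x) \<longlonglongrightarrow> 0"
proof -
  have bound: "\<bar>C n x\<bar> \<le> s * (X x)\<^sup>2 + (1 / s) * (Y n x)\<^sup>2" if "s > 0" "x \<in> space M" for s n x
  proof -
    have "2 * (sqrt s * \<bar>X x\<bar>) * (\<bar>Y n x\<bar> / sqrt s) \<le> (sqrt s * \<bar>X x\<bar>)\<^sup>2 + (\<bar>Y n x\<bar> / sqrt s)\<^sup>2"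
      by (rule sum_squares_bound)
    then have "2 * (\<bar>X x\<bar> * \<bar>Y n x\<bar>) \<le> s * (X x)\<^sup>2 + (1 / s) * (Y n x)\<^sup>2"
      using that by (simp add: power_mult_distrib power_divide)
    moreover have "0 \<le> \<bar>X x\<bar> * \<bar>Y n x\<bar>" by simp
    ultimately show ?thesis using le[OF that(2), of n] by linarith
  qed
  have I: "integrable M (\<lambda>x. s * (X x)\<^sup>2 + (1 / s) * (Y n x)\<^sup>2)" for s n
    using X Y by simp
  have CI: "integrable M (C n)" for n
    by (rule Bochner_Integration.integrable_bound[OF I[of 1 n] m])
      (use bound[of 1 _ n] in \<open>auto intro!: AE_I2\<close>)
  then show "integrable M (C n)" .
  show "(\<lambda>n. LINT x|M. C n x) \<longlonglongrightarrow> 0"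
    unfolding tendsto_iff
  proof (intro allI impI)
    fix e :: real assume "e > 0"
    define K where "K = (LINT x|M. (X x)\<^sup>2) + 1"
    have K: "K > 0" "(LINT x|M. (X x)\<^sup>2) \<le> K"
      by (auto simp: K_def add_nonneg_pos)
    \<comment> \<open>Each of the two terms of the bound contributes at most \<open>e / 2\<close>.\<close>
    define s where "s = e / (2 * K)"
    have s: "s > 0" "s * K = e / 2" using K \<open>e > 0\<close> by (auto simp: s_def)
    have "eventually (\<lambda>n. (LINT x|M. (Y n x)\<^sup>2) < s * (e / 2)) sequentially"
      using lim by (rule order_tendstoD) (use s \<open>e > 0\<close> in simp)
    then show "eventually (\<lambda>n. dist (LINT x|M. C n x) 0 < e) sequentially"
    proof eventually_elim
      case (elim n)
      have "norm (LINT x|M. C n x) \<le> (LINT x|M. s * (X x)\<^sup>2 + (1 / s) * (Y n x)\<^sup>2)"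
        by (rule order_trans[OF integral_norm_bound])
          (intro integral_mono integrable_norm CI I, use bound[OF s(1)] in simp)
      also have "\<dots> = s * (LINT x|M. (X x)\<^sup>2) + (1 / s) * (LINT x|M. (Y n x)\<^sup>2)"
        using X Y by simp
      also have "\<dots> < s * K + (1 / s) * (s * (e / 2))"
        using K s elim by (intro add_le_less_mono mult_left_mono mult_strict_left_mono) auto
      also have "\<dots> = e" using s by simp
      finally show ?case by simp
    qed
  qed
qed

lemma L2_tendsto_AE_subseq:
  fixes v :: "nat \<Rightarrow> 'a \<Rightarrow> real"
  assumes "\<And>n. integrable M (\<lambda>x. (v n x - w x)\<^sup>2)" "(\<lambda>n. LINT x|M. (v n x - w x)\<^sup>2) \<longlonglongrightarrow> 0"
  obtains s where "strict_mono (s :: nat \<Rightarrow> nat)" "AE x in M. (\<lambda>n. v (s n) x) \<longlonglongrightarrow> w x"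
proof -
  obtain s where s: "strict_mono s" and ae: "AE x in M. (\<lambda>n. (v (s n) x - w x)\<^sup>2) \<longlonglongrightarrow> 0"
  proof -
    have "(\<lambda>n. LINT x|M. norm ((v n x - w x)\<^sup>2)) \<longlonglongrightarrow> 0"
      using assms(2) by simp
    from tendsto_L1_AE_subseq[OF assms(1) this] show thesis
      using that by blast
  qed
  have "AE x in M. (\<lambda>n. v (s n) x) \<longlonglongrightarrow> w x"
    using ae
  proof eventually_elim
    case (elim x)
    have "(\<lambda>n. sqrt ((v (s n) x - w x)\<^sup>2)) \<longlonglongrightarrow> sqrt 0"
      by (intro tendsto_intros elim)
    then have "(\<lambda>n. v (s n) x - w x) \<longlonglongrightarrow> 0"
      by (simp add: tendsto_rabs_zero_iff)
    then show ?case by (simp add: LIM_zero_iff)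
  qed
  then show ?thesis using that s by blast
qed

text \<open>The equation is tested with \<open>\<zeta> arctan(v\<^sub>n)\<close>, where \<open>v\<^sub>n\<close> approximates \<open>w\<close> near \<open>p\<close>. Its gradient
  splits the left-hand side into the integrals of \<open>A\<close>, \<open>D\<close> and \<open>C\<close>. The first two, like the right-hand side \<open>R\<close>, depend on
  \<open>n\<close> only through the values \<open>v\<^sub>n\<close>, in a bounded way, and converge by dominated convergence along an almost everywhere
  convergent subsequence. The third carries the error \<open>V\<^sub>n - W\<close> of the gradients and tends to zero.\<close>

lemma weak_equation_local_arctan:
  fixes \<Omega> :: "(real^'n) set"
  assumes \<Omega>: "smooth_bounded_domain \<Omega>" and H1: "H1_gradient \<Omega> w W" and p: "p \<in> closure \<Omega>"
    and Fi: "integrable (lebesgue_on \<Omega>) (\<lambda>x. F (w x))"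
    and eq: "\<And>\<phi> \<Phi>. C1_closure_gradient \<Omega> \<phi> \<Phi> \<Longrightarrow>
      d * (LINT x|lebesgue_on \<Omega>. W x \<bullet> \<Phi> x) = (LINT x|lebesgue_on \<Omega>. F (w x) * \<phi> x)"
  shows "\<exists>r>0. \<forall>\<zeta> Z. C1_closure_gradient \<Omega> \<zeta> Z \<and> (\<forall>x\<in>\<Omega> - ball p r. \<zeta> x = 0 \<and> Z x = 0) \<longrightarrow>
    integrable (lebesgue_on \<Omega>) (\<lambda>x. d * (arctan (w x) * (W x \<bullet> Z x) + \<zeta> x * (inverse (1 + (w x)\<^sup>2) * (norm (W x))\<^sup>2))
        - F (w x) * (\<zeta> x * arctan (w x))) \<and>
    (LINT x|lebesgue_on \<Omega>. d * (arctan (w x) * (W x \<bullet> Z x) + \<zeta> x * (inverse (1 + (w x)\<^sup>2) * (norm (W x))\<^sup>2))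
        - F (w x) * (\<zeta> x * arctan (w x))) = 0"
proof -
  define M where "M = lebesgue_on \<Omega>"
  have spM: "space M = \<Omega>" by (simp add: M_def space_restrict_space)
  have op: "open \<Omega>" and bd: "bounded \<Omega>"
    using \<Omega> by (auto simp: smooth_bounded_domain_def)
  have S: "\<Omega> \<in> sets lebesgue" using op by (simp add: lborelD)
  have fin: "integrable M (\<lambda>x. 1 :: real)"
    unfolding M_def by (rule integrable_const_lebesgue_on[OF op bd])
  have wm[measurable]: "w \<in> borel_measurable M" and Wm[measurable]: "W \<in> borel_measurable M"
    and W2: "integrable M (\<lambda>x. (norm (W x))\<^sup>2)"
    using H1 by (auto simp: H1_gradient_def in_L2_def M_def)
  have W1: "integrable M (\<lambda>x. 1 + (norm (W x))\<^sup>2)"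
    using fin W2 by simp
  have Wle: "norm (W x) \<le> 1 + (norm (W x))\<^sup>2" for x
    using abs_le_one_plus_square[of "norm (W x)"] by simp
  obtain r v V where "r > 0"
    and vd: "\<And>n x. (v (n::nat) has_derivative (\<lambda>h. V n x \<bullet> h)) (at x)"
    and Vc: "\<And>n. continuous_on UNIV (V n)"
    and vi: "\<And>n. integrable M (\<lambda>x. (v n x - w x)\<^sup>2)"
    and vl: "(\<lambda>n. LINT x|M. (v n x - w x)\<^sup>2) \<longlonglongrightarrow> 0"
    and Vi: "\<And>n. integrable M (\<lambda>x. indicator (ball p r) x * (norm (V n x - W x))\<^sup>2)"
    and Vl: "(\<lambda>n. LINT x|M. indicator (ball p r) x * (norm (V n x - W x))\<^sup>2) \<longlonglongrightarrow> 0"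
    using local_smooth_approximation[OF \<Omega> H1 p] unfolding M_def by blast
  have vc: "continuous_on UNIV (v n)" for n
    using has_derivative_continuous[OF vd] by (intro continuous_at_imp_continuous_on) auto
  have vm[measurable]: "v n \<in> borel_measurable M" and Vm[measurable]: "V n \<in> borel_measurable M" for n
    using continuous_on_subset[OF vc subset_UNIV] continuous_on_subset[OF Vc subset_UNIV] S
    by (auto simp: M_def intro!: continuous_imp_measurable_on_sets_lebesgue)
  obtain s where s: "strict_mono (s :: nat \<Rightarrow> nat)" and sae: "AE x in M. (\<lambda>n. v (s n) x) \<longlonglongrightarrow> w x"
    by (rule L2_tendsto_AE_subseq[OF vi vl])
  have atan: "\<bar>arctan t\<bar> \<le> 2" for t
    using arctan_bounded[of t] pi_less_4 by (auto simp: abs_le_iff)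
  have inv: "0 \<le> inverse (1 + t\<^sup>2)" "inverse (1 + t\<^sup>2) \<le> 1" for t :: real
  proof -
    have "1 + t\<^sup>2 \<ge> 1" by simp
    then show "0 \<le> inverse (1 + t\<^sup>2)" "inverse (1 + t\<^sup>2) \<le> 1"
      by (auto intro: inverse_le_1_iff[THEN iffD2])
  qed
  show ?thesis
    unfolding M_def[symmetric]
  proof (intro exI[of _ r] conjI[OF \<open>r > 0\<close>] allI impI, elim conjE)
    fix \<zeta> Z assume C1: "C1_closure_gradient \<Omega> \<zeta> Z" and supp: "\<forall>x\<in>\<Omega> - ball p r. \<zeta> x = 0 \<and> Z x = 0"
    have \<zeta>c: "continuous_on (closure \<Omega>) \<zeta>" and Zc: "continuous_on (closure \<Omega>) Z"
      and \<zeta>d: "\<And>x. x \<in> \<Omega> \<Longrightarrow> (\<zeta> has_derivative (\<lambda>h. Z x \<bullet> h)) (at x)"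
      using C1 by (auto simp: C1_closure_gradient_def)
    have [measurable]: "\<zeta> \<in> borel_measurable M" "Z \<in> borel_measurable M"
      using continuous_on_subset[OF \<zeta>c closure_subset] continuous_on_subset[OF Zc closure_subset] S
      by (auto simp: M_def intro!: continuous_imp_measurable_on_sets_lebesgue)
    have comp: "compact (closure \<Omega>)" using bd by simp
    obtain B where B: "B > 0" "\<And>x. x \<in> \<Omega> \<Longrightarrow> \<bar>\<zeta> x\<bar> \<le> B" "\<And>x. x \<in> \<Omega> \<Longrightarrow> norm (Z x) \<le> B"
    proof -
      obtain B1 where "B1 > 0" "\<And>x. x \<in> closure \<Omega> \<Longrightarrow> norm (\<zeta> x) \<le> B1"
        using compact_imp_bounded[OF compact_continuous_image[OF \<zeta>c comp]] unfolding bounded_pos by auto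
      moreover obtain B2 where "B2 > 0" "\<And>x. x \<in> closure \<Omega> \<Longrightarrow> norm (Z x) \<le> B2"
        using compact_imp_bounded[OF compact_continuous_image[OF Zc comp]] unfolding bounded_pos by auto
      ultimately show thesis
        using that[of "B1 + B2"] closure_subset[of \<Omega>]
        by (metis add_increasing2 add_increasing add_pos_pos less_imp_le real_norm_def subsetD)
    qed
    define A where "A = (\<lambda>t x. arctan t * (W x \<bullet> Z x))"
    define D where "D = (\<lambda>t x. \<zeta> x * (inverse (1 + t\<^sup>2) * (norm (W x))\<^sup>2))"
    define R where "R = (\<lambda>t x. F (w x) * (\<zeta> x * arctan t))"
    define C where "C = (\<lambda>n x. \<zeta> x * (inverse (1 + (v n x)\<^sup>2) * (indicator (ball p r) x * (W x \<bullet> (V n x - W x)))))"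
    have [measurable]: "(\<lambda>x. F (w x)) \<in> borel_measurable M"
      using Fi by (auto simp: M_def)
    have indm[measurable]: "(indicator (ball p r) :: real^'n \<Rightarrow> real) \<in> borel_measurable M"
      unfolding M_def by (intro measurable_restrict_space1 measurable_completion borel_measurable_indicator) simp
    have Am[measurable]: "(\<lambda>x. A (f x) x) \<in> borel_measurable M"
      and Dm[measurable]: "(\<lambda>x. D (f x) x) \<in> borel_measurable M"
      and Rm[measurable]: "(\<lambda>x. R (f x) x) \<in> borel_measurable M" if [measurable]: "f \<in> borel_measurable M" for f
      unfolding A_def D_def R_def by measurable
    have Cm[measurable]: "C n \<in> borel_measurable M" for n
      unfolding C_def by measurable
    have Ab: "\<bar>A t x\<bar> \<le> 2 * B * (1 + (norm (W x))\<^sup>2)" if "x \<in> \<Omega>" for t x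
    proof -
      have "\<bar>W x \<bullet> Z x\<bar> \<le> norm (W x) * norm (Z x)" by (rule Cauchy_Schwarz_ineq2)
      also have "\<dots> \<le> (1 + (norm (W x))\<^sup>2) * B"
        using B(3)[OF that] Wle[of x] by (intro mult_mono) auto
      finally have "\<bar>arctan t\<bar> * \<bar>W x \<bullet> Z x\<bar> \<le> 2 * ((1 + (norm (W x))\<^sup>2) * B)"
        using atan[of t] by (intro mult_mono) auto
      then show ?thesis by (simp add: A_def abs_mult algebra_simps)
    qed
    have Db: "\<bar>D t x\<bar> \<le> B * (norm (W x))\<^sup>2" if "x \<in> \<Omega>" for t x
    proof -
      have "\<bar>\<zeta> x\<bar> * (inverse (1 + t\<^sup>2) * (norm (W x))\<^sup>2) \<le> B * (1 * (norm (W x))\<^sup>2)"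
        using B that inv[of t] by (intro mult_mono mult_nonneg_nonneg) auto
      then show ?thesis using inv[of t] by (simp add: D_def abs_mult)
    qed
    have Rb: "\<bar>R t x\<bar> \<le> (2 * B) * \<bar>F (w x)\<bar>" if "x \<in> \<Omega>" for t x
    proof -
      have "\<bar>\<zeta> x\<bar> * \<bar>arctan t\<bar> \<le> B * 2"
        using B that atan[of t] by (intro mult_mono) auto
      then have "\<bar>F (w x)\<bar> * (\<bar>\<zeta> x\<bar> * \<bar>arctan t\<bar>) \<le> \<bar>F (w x)\<bar> * (B * 2)"
        by (rule mult_left_mono) simp
      then show ?thesis by (simp add: R_def abs_mult mult_ac)
    qed
    have Ai: "integrable M (\<lambda>x. 2 * B * (1 + (norm (W x))\<^sup>2))" using W1 by simp
    have Di: "integrable M (\<lambda>x. B * (norm (W x))\<^sup>2)" using W2 by simp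
    have Ri: "integrable M (\<lambda>x. (2 * B) * \<bar>F (w x)\<bar>)" using Fi by (simp add: M_def)
    have AE\<Omega>: "AE x in M. x \<in> \<Omega>" using AE_space[of M] by (simp add: spM)
    have intA: "integrable M (\<lambda>x. A (f x) x)" and intD: "integrable M (\<lambda>x. D (f x) x)"
      and intR: "integrable M (\<lambda>x. R (f x) x)" if "f \<in> borel_measurable M" for f
    proof -
      show "integrable M (\<lambda>x. A (f x) x)"
        by (rule Bochner_Integration.integrable_bound[OF Ai Am[OF that]])
          (use AE\<Omega> in eventually_elim, use B Ab in \<open>auto simp: abs_of_nonneg\<close>)
      show "integrable M (\<lambda>x. D (f x) x)"
        by (rule Bochner_Integration.integrable_bound[OF Di Dm[OF that]])
          (use AE\<Omega> in eventually_elim, use B Db in \<open>auto simp: abs_of_nonneg\<close>)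
      show "integrable M (\<lambda>x. R (f x) x)"
        by (rule Bochner_Integration.integrable_bound[OF Ri Rm[OF that]])
          (use AE\<Omega> in eventually_elim, use B Rb in \<open>auto simp: abs_of_nonneg\<close>)
    qed
    have Cb: "\<bar>C n x\<bar> \<le> \<bar>B * norm (W x)\<bar> * \<bar>indicator (ball p r) x * norm (V n x - W x)\<bar>" if "x \<in> space M" for n x
    proof -
      have "\<bar>\<zeta> x\<bar> * (inverse (1 + (v n x)\<^sup>2) * (indicator (ball p r) x * \<bar>W x \<bullet> (V n x - W x)\<bar>))
        \<le> B * (1 * (indicator (ball p r) x * (norm (W x) * norm (V n x - W x))))"
        using B that inv[of "v n x"] Cauchy_Schwarz_ineq2[of "W x" "V n x - W x"] unfolding spM
        by (intro mult_mono mult_nonneg_nonneg) auto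
      then show ?thesis
        using inv[of "v n x"] B(1) by (simp add: C_def abs_mult mult_ac)
    qed
    have X2: "integrable M (\<lambda>x. (B * norm (W x))\<^sup>2)"
      using W2 by (simp add: power_mult_distrib)
    have Yeq: "(indicator (ball p r) x * norm (V n x - W x))\<^sup>2 = indicator (ball p r) x * (norm (V n x - W x))\<^sup>2" for n x
      by (auto simp: indicator_def)
    note Cres = L2_product_tendsto_0[OF X2 Vi[folded Yeq] Vl[folded Yeq] Cm Cb]
    have eqn: "d * ((LINT x|M. A (v n x) x) + (LINT x|M. D (v n x) x) + (LINT x|M. C n x)) = (LINT x|M. R (v n x) x)" for n
    proof -
      define \<phi> where "\<phi> = (\<lambda>x. \<zeta> x * arctan (v n x))"
      define \<Phi> where "\<Phi> = (\<lambda>x. arctan (v n x) *\<^sub>R Z x + (\<zeta> x * inverse (1 + (v n x)\<^sup>2)) *\<^sub>R V n x)"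
      have pos: "1 + (v n x)\<^sup>2 \<noteq> 0" for x
        using zero_le_power2[of "v n x"] by linarith
      have "C1_closure_gradient \<Omega> \<phi> \<Phi>"
        unfolding C1_closure_gradient_def
      proof (intro conjI ballI)
        show "continuous_on (closure \<Omega>) \<phi>"
          unfolding \<phi>_def by (intro continuous_intros \<zeta>c continuous_on_subset[OF vc subset_UNIV])
        show "continuous_on (closure \<Omega>) \<Phi>"
          unfolding \<Phi>_def
          by (intro continuous_intros \<zeta>c Zc continuous_on_subset[OF vc subset_UNIV] continuous_on_subset[OF Vc subset_UNIV])
            (use pos in auto)
        show "(\<phi> has_derivative (\<lambda>h. \<Phi> x \<bullet> h)) (at x)" if "x \<in> \<Omega>" for x
        proof -
          have "((\<lambda>x. arctan (v n x)) has_derivative (\<lambda>h. inverse (1 + (v n x)\<^sup>2) * (V n x \<bullet> h))) (at x)"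
            using has_derivative_compose[OF vd[of n x] DERIV_arctan[of "v n x", unfolded has_field_derivative_def]]
            by simp
          from has_derivative_mult[OF \<zeta>d[OF that] this]
          show ?thesis
            unfolding \<phi>_def by (rule has_derivative_eq_rhs) (auto simp: \<Phi>_def inner_add_left)
        qed
      qed
      then have "d * (LINT x|M. W x \<bullet> \<Phi> x) = (LINT x|M. F (w x) * \<phi> x)"
        using eq unfolding M_def by blast
      moreover have "(LINT x|M. W x \<bullet> \<Phi> x) = (LINT x|M. A (v n x) x + D (v n x) x + C n x)"
      proof (rule Bochner_Integration.integral_cong[OF refl])
        fix x assume "x \<in> space M"
        then have x: "x \<in> \<Omega>" by (simp add: spM)
        have "\<zeta> x * inverse (1 + (v n x)\<^sup>2) * (W x \<bullet> V n x) = D (v n x) x + C n x"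
        proof (cases "x \<in> ball p r")
          case True
          then show ?thesis
            by (simp add: D_def C_def inner_diff_right power2_norm_eq_inner algebra_simps)
        next
          case False
          then have "\<zeta> x = 0" using supp x by blast
          then show ?thesis by (simp add: D_def C_def)
        qed
        then show "W x \<bullet> \<Phi> x = A (v n x) x + D (v n x) x + C n x"
          by (simp add: \<Phi>_def A_def inner_add_right)
      qed
      ultimately show ?thesis
        using intA[OF vm] intD[OF vm] Cres(1) by (simp add: R_def \<phi>_def)
    qed
    have limA: "(\<lambda>n. LINT x|M. A (v (s n) x) x) \<longlonglongrightarrow> (LINT x|M. A (w x) x)"
    proof (rule integral_dominated_convergence[OF Am[OF wm] Am[OF vm] Ai])
      show "AE x in M. (\<lambda>n. A (v (s n) x) x) \<longlonglongrightarrow> A (w x) x"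
        using sae by eventually_elim (auto simp: A_def intro!: tendsto_intros)
      show "AE x in M. norm (A (v (s n) x) x) \<le> 2 * B * (1 + (norm (W x))\<^sup>2)" for n
        using AE\<Omega> by eventually_elim (use Ab in auto)
    qed
    have limD: "(\<lambda>n. LINT x|M. D (v (s n) x) x) \<longlonglongrightarrow> (LINT x|M. D (w x) x)"
    proof (rule integral_dominated_convergence[OF Dm[OF wm] Dm[OF vm] Di])
      show "AE x in M. (\<lambda>n. D (v (s n) x) x) \<longlonglongrightarrow> D (w x) x"
        using sae
      proof eventually_elim
        case (elim x)
        have "1 + (w x)\<^sup>2 \<noteq> 0" using zero_le_power2[of "w x"] by linarith
        then show ?case unfolding D_def by (intro tendsto_intros elim)
      qed
      show "AE x in M. norm (D (v (s n) x) x) \<le> B * (norm (W x))\<^sup>2" for n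
        using AE\<Omega> by eventually_elim (use Db in auto)
    qed
    have limR: "(\<lambda>n. LINT x|M. R (v (s n) x) x) \<longlonglongrightarrow> (LINT x|M. R (w x) x)"
    proof (rule integral_dominated_convergence[OF Rm[OF wm] Rm[OF vm] Ri])
      show "AE x in M. (\<lambda>n. R (v (s n) x) x) \<longlonglongrightarrow> R (w x) x"
        using sae by eventually_elim (auto simp: R_def intro!: tendsto_intros)
      show "AE x in M. norm (R (v (s n) x) x) \<le> (2 * B) * \<bar>F (w x)\<bar>" for n
        using AE\<Omega> by eventually_elim (use Rb in auto)
    qed
    have limC: "(\<lambda>n. LINT x|M. C (s n) x) \<longlonglongrightarrow> 0"
      using LIMSEQ_subseq_LIMSEQ[OF Cres(2) s] by (simp add: o_def)
    have "(\<lambda>n. LINT x|M. R (v (s n) x) x) \<longlonglongrightarrow> d * ((LINT x|M. A (w x) x) + (LINT x|M. D (w x) x) + 0)"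
      unfolding eqn[symmetric] by (intro tendsto_intros limA limD limC)
    then have lim_eq: "(LINT x|M. R (w x) x) = d * ((LINT x|M. A (w x) x) + (LINT x|M. D (w x) x))"
      using LIMSEQ_unique[OF limR] by simp
    have int: "integrable M (\<lambda>x. d * (A (w x) x + D (w x) x) - R (w x) x)"
      using intA[OF wm] intD[OF wm] intR[OF wm] by simp
    have "(LINT x|M. d * (A (w x) x + D (w x) x) - R (w x) x) = 0"
      using intA[OF wm] intD[OF wm] intR[OF wm] lim_eq by simp
    with int show "integrable M (\<lambda>x. d * (arctan (w x) * (W x \<bullet> Z x) + \<zeta> x * (inverse (1 + (w x)\<^sup>2) * (norm (W x))\<^sup>2))
        - F (w x) * (\<zeta> x * arctan (w x))) \<and>
      (LINT x|M. d * (arctan (w x) * (W x \<bullet> Z x) + \<zeta> x * (inverse (1 + (w x)\<^sup>2) * (norm (W x))\<^sup>2))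
        - F (w x) * (\<zeta> x * arctan (w x))) = 0"
      unfolding A_def D_def R_def by blast
  qed
qed

text \<open>Finitely many bumps cover the compact closure; each is divided by their sum. Only the gradients on the closure
  matter, so it is harmless that the quotients are badly behaved where the sum vanishes.\<close>

lemma partition_of_unity_on_closure:
  fixes \<Omega> :: "(real^'n) set"
  assumes "bounded \<Omega>" and r: "\<And>p. p \<in> closure \<Omega> \<Longrightarrow> r p > 0"
  shows "\<exists>P \<zeta> Z. finite P \<and> P \<subseteq> closure \<Omega> \<and>
    (\<forall>p\<in>P. C1_closure_gradient \<Omega> (\<zeta> p) (Z p) \<and> (\<forall>x. x \<notin> ball p (r p) \<longrightarrow> \<zeta> p x = 0 \<and> Z p x = 0)) \<and>
    (\<forall>x\<in>closure \<Omega>. (\<Sum>p\<in>P. \<zeta> p x) = 1 \<and> (\<Sum>p\<in>P. Z p x) = 0)"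
proof -
  have "\<exists>l u. cbox l u \<subseteq> ball p (r p) \<and> p \<in> box l u" if "p \<in> closure \<Omega>" for p
    using open_contains_cbox[of "ball p (r p)" p] r[OF that] by (metis centre_in_ball open_ball)
  then obtain l u where lu: "\<And>p. p \<in> closure \<Omega> \<Longrightarrow> cbox (l p) (u p) \<subseteq> ball p (r p)"
    "\<And>p. p \<in> closure \<Omega> \<Longrightarrow> p \<in> box (l p) (u p)"
    by metis
  have "compact (closure \<Omega>)" using assms(1) by simp
  then obtain P where P: "P \<subseteq> closure \<Omega>" "finite P" "closure \<Omega> \<subseteq> (\<Union>p\<in>P. box (l p) (u p))"
    using lu(2) by (elim compactE_image[where C="closure \<Omega>" and f="\<lambda>p. box (l p) (u p)"]) (auto simp: open_box)
  define k where "k = (\<lambda>p. unit_bump (l p) (u p))"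
  define S where "S = (\<lambda>x. \<Sum>p\<in>P. k p x)"
  define T where "T = (\<lambda>x. \<Sum>p\<in>P. grad (k p) x)"
  define \<zeta> where "\<zeta> = (\<lambda>p x. k p x / S x)"
  define Z where "Z = (\<lambda>p x. (1 / S x) *\<^sub>R grad (k p) x - (k p x / (S x)\<^sup>2) *\<^sub>R T x)"
  have kd: "(k p has_derivative (\<lambda>h. grad (k p) x \<bullet> h)) (at x)" for p x
    unfolding k_def by (rule smooth_has_grad[OF smooth_unit_bump])
  have kc: "continuous_on X (k p)" "continuous_on X (grad (k p))" for p X
    unfolding k_def using continuous_on_subset[OF smooth_continuous[OF smooth_unit_bump] subset_UNIV]
      continuous_on_subset[OF smooth_continuous_grad[OF smooth_unit_bump] subset_UNIV] by auto
  have ne: "box (l p) (u p) \<noteq> {}" if "p \<in> P" for p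
    using lu(2)[of p] P(1) that by auto
  have k0: "k p x \<ge> 0" if "p \<in> P" for p x
    unfolding k_def unit_bump_def using bump_nonneg bump_integral_pos[OF ne[OF that]] by (rule divide_nonneg_pos)
  have Spos: "S x > 0" if "x \<in> closure \<Omega>" for x
  proof -
    obtain p where p: "p \<in> P" "x \<in> box (l p) (u p)" using P(3) \<open>x \<in> closure \<Omega>\<close> by blast
    have "k p x \<noteq> 0"
      using bump_neq_0_iff[of "l p" "u p" x] bump_integral_pos[OF ne[OF p(1)]] p(2) by (simp add: k_def unit_bump_def)
    then have "k p x > 0" using k0[OF p(1), of x] by simp
    then show ?thesis
      unfolding S_def using k0 P(2) p(1) by (intro sum_pos2[of P p]) auto
  qed
  have Sd: "(S has_derivative (\<lambda>h. T x \<bullet> h)) (at x)" for x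
    unfolding S_def T_def inner_sum_left by (intro has_derivative_sum kd)
  have Sc: "continuous_on X S" "continuous_on X T" for X
    unfolding S_def T_def by (intro continuous_on_sum kc)+
  show ?thesis
  proof (intro exI conjI ballI allI impI)
    show "finite P" "P \<subseteq> closure \<Omega>" by (fact P)+
    show "C1_closure_gradient \<Omega> (\<zeta> p) (Z p)" for p
      unfolding C1_closure_gradient_def
    proof (intro conjI ballI)
      show "continuous_on (closure \<Omega>) (\<zeta> p)"
        unfolding \<zeta>_def by (intro continuous_intros kc Sc) (use Spos in force)
      show "continuous_on (closure \<Omega>) (Z p)"
        unfolding Z_def by (intro continuous_intros kc Sc) (use Spos in force)+
      show "(\<zeta> p has_derivative (\<lambda>h. Z p x \<bullet> h)) (at x)" if "x \<in> \<Omega>" for x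
      proof -
        have "S x \<noteq> 0" using Spos closure_subset \<open>x \<in> \<Omega>\<close> by force
        then show ?thesis
          unfolding \<zeta>_def
          by (auto intro!: derivative_eq_intros kd Sd simp: Z_def inner_diff_left field_simps power2_eq_square)
      qed
    qed
    show "\<zeta> p x = 0" "Z p x = 0" if "p \<in> P" "x \<notin> ball p (r p)" for p x
    proof -
      have "x \<notin> cbox (l p) (u p)" using lu(1)[of p] that P(1) by blast
      then have "k p x = 0" "grad (k p) x = 0"
        using grad_eq_0_outside_cbox[of x "l p" "u p"] bump_neq_0_iff[of "l p" "u p" x] box_subset_cbox[of "l p" "u p"]
        by (auto simp: k_def unit_bump_def)
      then show "\<zeta> p x = 0" "Z p x = 0" by (simp_all add: \<zeta>_def Z_def)
    qed
    show "(\<Sum>p\<in>P. \<zeta> p x) = 1" if "x \<in> closure \<Omega>" for x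
      using Spos[OF that] by (simp add: \<zeta>_def S_def sum_divide_distrib[symmetric])
    show "(\<Sum>p\<in>P. Z p x) = 0" if "x \<in> closure \<Omega>" for x
    proof -
      have "(\<Sum>p\<in>P. Z p x) = (1 / S x) *\<^sub>R T x - (S x / (S x)\<^sup>2) *\<^sub>R T x"
        by (simp add: Z_def sum_subtractf T_def S_def scaleR_sum_right[symmetric] scaleR_sum_left[symmetric] sum_divide_distrib[symmetric])
      then show ?thesis using Spos[OF that] by (simp add: power2_eq_square)
    qed
  qed
qed

text \<open>The localized identity is linear in the pair of \<open>\<zeta>\<close> and its gradient. Over a partition of unity
  these pairs add up to \<open>1\<close> and \<open>0\<close>.\<close>

lemma weak_equation_arctan:
  fixes \<Omega> :: "(real^'n) set"
  assumes \<Omega>: "smooth_bounded_domain \<Omega>" and H1: "H1_gradient \<Omega> w W"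
    and Fi: "integrable (lebesgue_on \<Omega>) (\<lambda>x. F (w x))"
    and eq: "\<And>\<phi> \<Phi>. C1_closure_gradient \<Omega> \<phi> \<Phi> \<Longrightarrow>
      d * (LINT x|lebesgue_on \<Omega>. W x \<bullet> \<Phi> x) = (LINT x|lebesgue_on \<Omega>. F (w x) * \<phi> x)"
  shows "integrable (lebesgue_on \<Omega>) (\<lambda>x. d * (inverse (1 + (w x)\<^sup>2) * (norm (W x))\<^sup>2) - F (w x) * arctan (w x))"
    and "(LINT x|lebesgue_on \<Omega>. d * (inverse (1 + (w x)\<^sup>2) * (norm (W x))\<^sup>2) - F (w x) * arctan (w x)) = 0"
proof -
  define E where "E = (\<lambda>\<zeta> Z x. d * (arctan (w x) * (W x \<bullet> Z x) + \<zeta> x * (inverse (1 + (w x)\<^sup>2) * (norm (W x))\<^sup>2))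
        - F (w x) * (\<zeta> x * arctan (w x)))"
  have bd: "bounded \<Omega>" using \<Omega> by (simp add: smooth_bounded_domain_def)
  have "\<exists>r>0. \<forall>\<zeta> Z. C1_closure_gradient \<Omega> \<zeta> Z \<and> (\<forall>x\<in>\<Omega> - ball p r. \<zeta> x = 0 \<and> Z x = 0) \<longrightarrow>
      integrable (lebesgue_on \<Omega>) (E \<zeta> Z) \<and> (LINT x|lebesgue_on \<Omega>. E \<zeta> Z x) = 0" if "p \<in> closure \<Omega>" for p
    using weak_equation_local_arctan[OF \<Omega> H1 that Fi eq] unfolding E_def by blast
  then obtain r where r: "\<And>p. p \<in> closure \<Omega> \<Longrightarrow> r p > 0"
    and loc: "\<And>p \<zeta> Z. p \<in> closure \<Omega> \<Longrightarrow> C1_closure_gradient \<Omega> \<zeta> Z \<Longrightarrow> (\<forall>x\<in>\<Omega> - ball p (r p). \<zeta> x = 0 \<and> Z x = 0) \<Longrightarrow>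
      integrable (lebesgue_on \<Omega>) (E \<zeta> Z) \<and> (LINT x|lebesgue_on \<Omega>. E \<zeta> Z x) = 0"
    by metis
  obtain P \<zeta> Z where P: "finite P" "P \<subseteq> closure \<Omega>"
    and C1: "\<And>p. p \<in> P \<Longrightarrow> C1_closure_gradient \<Omega> (\<zeta> p) (Z p)"
    and supp: "\<And>p x. p \<in> P \<Longrightarrow> x \<notin> ball p (r p) \<Longrightarrow> \<zeta> p x = 0 \<and> Z p x = 0"
    and s1: "\<And>x. x \<in> closure \<Omega> \<Longrightarrow> (\<Sum>p\<in>P. \<zeta> p x) = 1"
    and s0: "\<And>x. x \<in> closure \<Omega> \<Longrightarrow> (\<Sum>p\<in>P. Z p x) = 0"
    using partition_of_unity_on_closure[of \<Omega> r, OF bd r] by blast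
  have I: "integrable (lebesgue_on \<Omega>) (E (\<zeta> p) (Z p))" "(LINT x|lebesgue_on \<Omega>. E (\<zeta> p) (Z p) x) = 0" if "p \<in> P" for p
    using loc[OF _ C1[OF that]] supp[OF that] P(2) that by blast+
  have sum: "(\<Sum>p\<in>P. E (\<zeta> p) (Z p) x) = d * (inverse (1 + (w x)\<^sup>2) * (norm (W x))\<^sup>2) - F (w x) * arctan (w x)"
    if "x \<in> space (lebesgue_on \<Omega>)" for x
  proof -
    have x: "x \<in> closure \<Omega>" using that closure_subset[of \<Omega>] by (auto simp: space_restrict_space)
    have "(\<Sum>p\<in>P. E (\<zeta> p) (Z p) x) = d * (arctan (w x) * (W x \<bullet> (\<Sum>p\<in>P. Z p x)) + (\<Sum>p\<in>P. \<zeta> p x) * (inverse (1 + (w x)\<^sup>2) * (norm (W x))\<^sup>2))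
        - F (w x) * ((\<Sum>p\<in>P. \<zeta> p x) * arctan (w x))"
      unfolding E_def by (simp only: sum_subtractf sum.distrib sum_distrib_left sum_distrib_right inner_sum_right distrib_left)
    then show ?thesis by (simp add: s1[OF x] s0[OF x])
  qed
  have "integrable (lebesgue_on \<Omega>) (\<lambda>x. \<Sum>p\<in>P. E (\<zeta> p) (Z p) x)"
    using I by simp
  then show "integrable (lebesgue_on \<Omega>) (\<lambda>x. d * (inverse (1 + (w x)\<^sup>2) * (norm (W x))\<^sup>2) - F (w x) * arctan (w x))"
    by (simp only: sum cong: Bochner_Integration.integrable_cong)
  have "(LINT x|lebesgue_on \<Omega>. (\<Sum>p\<in>P. E (\<zeta> p) (Z p) x)) = 0"
    using I by simp
  then show "(LINT x|lebesgue_on \<Omega>. d * (inverse (1 + (w x)\<^sup>2) * (norm (W x))\<^sup>2) - F (w x) * arctan (w x)) = 0"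
    by (simp only: sum cong: Bochner_Integration.integral_cong)
qed

section \<open>Functions with vanishing weak gradient\<close>

lemma AE_lebesgue_open_ex:
  fixes S :: "'a::euclidean_space set"
  assumes "open S" "S \<noteq> {}" "AE x in lebesgue. x \<in> S \<longrightarrow> P x"
  shows "\<exists>x\<in>S. P x"
proof (rule ccontr)
  assume "\<not> ?thesis"
  then have "AE x in lebesgue. x \<notin> S"
    using assms(3) by (auto elim: eventually_mono)
  then have "S \<in> null_sets lebesgue"
    using assms(1) by (subst AE_iff_null_sets) (auto simp: lborelD)
  then show False
    using open_not_negligible[OF assms(1,2)] by (simp add: negligible_iff_null_sets)
qed

text \<open>In a ball around an inner point the smooth approximations are constant, hence so is their limit \<open>w\<close>. The
  local constants agree where balls overlap, so connectedness makes them equal, and countably many of the balls suffice to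
  cover \<open>\<Omega>\<close>.\<close>

lemma zero_gradient_imp_constant:
  fixes \<Omega> :: "(real^'n) set"
  assumes \<Omega>: "smooth_bounded_domain \<Omega>" and H1: "H1_gradient \<Omega> w W" and W0: "AE x in lebesgue_on \<Omega>. W x = 0"
  obtains c where "AE x in lebesgue_on \<Omega>. w x = c"
proof -
  have op: "open \<Omega>" and con: "connected \<Omega>" and ne: "\<Omega> \<noteq> {}"
    using \<Omega> by (auto simp: smooth_bounded_domain_def)
  have S: "\<Omega> \<in> sets lebesgue" using op by (simp add: lborelD)
  have "\<exists>r c. r > 0 \<and> ball p r \<subseteq> \<Omega> \<and> (AE x in lebesgue. x \<in> ball p r \<longrightarrow> w x = c)" if "p \<in> \<Omega>" for p
  proof -
    have "p \<in> closure \<Omega>" using \<open>p \<in> \<Omega>\<close> closure_subset by blast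
    then obtain r v V where "r > 0"
      and vd: "\<And>n x. (v (n::nat) has_derivative (\<lambda>h. V n x \<bullet> h)) (at x)"
      and vi: "\<And>n. integrable (lebesgue_on \<Omega>) (\<lambda>x. (v n x - w x)\<^sup>2)"
      and vl: "(\<lambda>n. LINT x|lebesgue_on \<Omega>. (v n x - w x)\<^sup>2) \<longlonglongrightarrow> 0"
      and V0: "\<And>n x. x \<in> \<Omega> \<inter> ball p r \<Longrightarrow> V n x = 0"
      using local_smooth_approximation[OF \<Omega> H1, of p] W0 by blast
    obtain \<rho>' where "\<rho>' > 0" "ball p \<rho>' \<subseteq> \<Omega>" using op \<open>p \<in> \<Omega>\<close> openE by blast
    define \<rho> where "\<rho> = min r \<rho>'"
    have \<rho>: "\<rho> > 0" "ball p \<rho> \<subseteq> \<Omega>" "ball p \<rho> \<subseteq> ball p r"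
      using \<open>r > 0\<close> \<open>\<rho>' > 0\<close> \<open>ball p \<rho>' \<subseteq> \<Omega>\<close> by (auto simp: \<rho>_def)
    have const: "v n x = v n p" if "x \<in> ball p \<rho>" for n x
    proof (rule has_derivative_zero_unique[of "ball p \<rho>"])
      show "(v n has_derivative (\<lambda>h. 0)) (at y within ball p \<rho>)" if "y \<in> ball p \<rho>" for y
      proof -
        have "V n y = 0" using V0 \<rho> that by blast
        then show ?thesis using has_derivative_at_withinI[OF vd[of n y]] by simp
      qed
    qed (use that \<rho> in auto)
    obtain s where sae: "AE x in lebesgue_on \<Omega>. (\<lambda>n. v (s n) x) \<longlonglongrightarrow> w x"
      by (rule L2_tendsto_AE_subseq[OF vi vl])
    then have "AE x in lebesgue. x \<in> \<Omega> \<longrightarrow> (\<lambda>n. v (s n) x) \<longlonglongrightarrow> w x"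
      using S by (subst (asm) AE_restrict_space_iff) auto
    then have ae: "AE x in lebesgue. x \<in> ball p \<rho> \<longrightarrow> (\<lambda>n. v (s n) p) \<longlonglongrightarrow> w x"
    proof eventually_elim
      case (elim x)
      show ?case
      proof
        assume "x \<in> ball p \<rho>"
        then show "(\<lambda>n. v (s n) p) \<longlonglongrightarrow> w x"
          using elim \<rho>(2) const[of x] by auto
      qed
    qed
    obtain x0 where x0: "(\<lambda>n. v (s n) p) \<longlonglongrightarrow> w x0"
      using AE_lebesgue_open_ex[OF open_ball _ ae] \<rho>(1) by auto
    have "AE x in lebesgue. x \<in> ball p \<rho> \<longrightarrow> w x = w x0"
      using ae by eventually_elim (use LIMSEQ_unique[OF _ x0] in blast)
    then show ?thesis using \<rho> by blast
  qed
  then have "\<forall>p\<in>\<Omega>. \<exists>r c. r > 0 \<and> ball p r \<subseteq> \<Omega> \<and> (AE x in lebesgue. x \<in> ball p r \<longrightarrow> w x = c)"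
    by (rule ballI)
  then obtain r c where rc: "\<forall>p\<in>\<Omega>. r p > 0 \<and> ball p (r p) \<subseteq> \<Omega> \<and>
      (AE x in lebesgue. x \<in> ball p (r p) \<longrightarrow> w x = c p)"
    unfolding bchoice_iff by (elim exE)
  have rpos: "r p > 0" and rae: "AE x in lebesgue. x \<in> ball p (r p) \<longrightarrow> w x = c p" if "p \<in> \<Omega>" for p
    using bspec[OF rc that] by simp_all
  have same: "c p = c q" if "p \<in> \<Omega>" "q \<in> \<Omega>" for p q
  proof (rule connected_local_const[OF con that])
    show "\<forall>a\<in>\<Omega>. eventually (\<lambda>b. c a = c b) (at a within \<Omega>)"
    proof
      fix a assume a: "a \<in> \<Omega>"
      have "c a = c b" if b: "b \<in> \<Omega>" "b \<in> ball a (r a)" for b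
      proof -
        let ?B = "ball a (r a) \<inter> ball b (r b)"
        have "AE x in lebesgue. x \<in> ?B \<longrightarrow> c a = c b"
          using rae[OF a] rae[OF b(1)] by eventually_elim auto
        moreover have "b \<in> ?B" using b rpos[OF b(1)] by simp
        ultimately show ?thesis
          using AE_lebesgue_open_ex[of ?B "\<lambda>_. c a = c b"] by blast
      qed
      then show "eventually (\<lambda>b. c a = c b) (at a within \<Omega>)"
        unfolding eventually_at_topological using rpos[OF a]
        by (intro exI[of _ "ball a (r a)"]) auto
    qed
  qed
  obtain p0 where p0: "p0 \<in> \<Omega>" using ne by blast
  obtain \<F>' where \<F>': "\<F>' \<subseteq> (\<lambda>p. ball p (r p)) ` \<Omega>" "countable \<F>'" "\<Union>\<F>' = \<Union>((\<lambda>p. ball p (r p)) ` \<Omega>)"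
    using Lindelof[of "(\<lambda>p. ball p (r p)) ` \<Omega>"] by blast
  have cover: "\<Omega> \<subseteq> \<Union>\<F>'"
    unfolding \<F>'(3) using rpos by (auto intro!: bexI)
  have "AE x in lebesgue. \<forall>B\<in>\<F>'. x \<in> B \<longrightarrow> w x = c p0"
    unfolding AE_ball_countable[OF \<F>'(2)]
  proof
    fix B assume "B \<in> \<F>'"
    then obtain p where p: "p \<in> \<Omega>" "B = ball p (r p)" using \<F>'(1) by blast
    show "AE x in lebesgue. x \<in> B \<longrightarrow> w x = c p0"
      using rae[OF p(1)] same[OF p(1) p0] p(2) by simp
  qed
  then have "AE x in lebesgue. x \<in> \<Omega> \<longrightarrow> w x = c p0"
    by eventually_elim (use cover in blast)
  then have "AE x in lebesgue_on \<Omega>. w x = c p0"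
    using S by (subst AE_restrict_space_iff) auto
  then show thesis by (rule that)
qed

section \<open>Constants as weak solutions\<close>

text \<open>By translation invariance, \<open>\<integral> \<psi>(y - x) dy\<close> does not depend on \<open>x\<close>. Near the origin it equals the mollification of the indicator
  of a large ball with kernel \<open>\<psi>\<close>, whose derivative there is minus the integral of the gradient.\<close>

lemma integral_grad_compact_support:
  fixes \<psi> :: "real^'n \<Rightarrow> real"
  assumes sm: "smooth \<psi>" and \<psi>0: "\<And>x. norm x > R \<Longrightarrow> \<psi> x = 0"
  shows "(LINT x|lborel. grad \<psi> x) = 0"
proof -
  have g0: "grad \<psi> x = 0" if "norm x > R" for x
    by (rule grad_eq_0_off_support[OF closed_cball, of 0 R]) (use that \<psi>0 in auto)
  have m[measurable]: "\<psi> \<in> borel_measurable borel"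
    using smooth_continuous[OF sm] by (rule borel_measurable_continuous_onI)
  define g :: "real^'n \<Rightarrow> real" where "g = indicator (cball 0 (R + 1))"
  have gi: "integrable lborel g"
    using emeasure_bounded_finite[OF bounded_cball, of "0::real^'n" "R + 1"]
    unfolding g_def by (intro integrable_real_indicator) auto
  define D where "D = - (LINT y|lborel. g y *\<^sub>R grad \<psi> (y - 0))"
  have D: "(mollify \<psi> g has_derivative (\<lambda>v. D \<bullet> v)) (at 0)"
    unfolding D_def
    by (rule mollify_has_derivative(1)[OF smooth_has_grad[OF sm] smooth_continuous_grad[OF sm] g0 \<psi>0 gi])
  have const: "mollify \<psi> g x = (LINT z|lborel. \<psi> z)" if "norm x < 1" for x
  proof -
    have "mollify \<psi> g x = mollify \<psi> (\<lambda>_. 1) x"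
      unfolding mollify_def
    proof (rule Bochner_Integration.integral_cong[OF refl])
      fix y
      have "norm y \<le> norm (y - x) + norm x" by norm
      then show "\<psi> (y - x) * g y = \<psi> (y - x) * 1"
        using \<psi>0[of "y - x"] that by (cases "norm y \<le> R + 1") (auto simp: g_def)
    qed
    also have "\<dots> = (LINT z|lborel. \<psi> z)"
      by (subst mollify_shift) auto
    finally show ?thesis .
  qed
  have "(mollify \<psi> g has_derivative (\<lambda>v. 0)) (at 0)"
    by (rule has_derivative_transform_within_open[OF has_derivative_const open_ball[of 0 1]])
      (use const in auto)
  then have "(\<lambda>v. D \<bullet> v) = (\<lambda>v. 0)"
    using D has_derivative_unique by blast
  then have "D \<bullet> D = 0" by meson
  then have "D = 0" by simp
  moreover have "(\<lambda>y. g y *\<^sub>R grad \<psi> (y - 0)) = grad \<psi>"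
    using g0 by (auto simp: g_def fun_eq_iff indicator_def)
  ultimately show ?thesis
    by (simp add: D_def)
qed

lemma integral_test_function_derivative:
  fixes \<psi> :: "real^'n \<Rightarrow> real"
  assumes op: "open \<Omega>" and \<psi>: "test_function \<Omega> \<psi>"
  shows "(LINT x|lebesgue_on \<Omega>. frechet_derivative \<psi> (at x) (axis i 1)) = 0"
proof -
  let ?K = "closure {x. \<psi> x \<noteq> 0}"
  have sm: "smooth \<psi>" and K: "compact ?K" "?K \<subseteq> \<Omega>"
    using \<psi> by (auto simp: test_function_def)
  have \<psi>0: "\<psi> x = 0" if "x \<notin> ?K" for x
    using that closure_subset[of "{x. \<psi> x \<noteq> 0}"] by blast
  obtain R where "\<forall>x\<in>?K. norm x \<le> R"
    using compact_imp_bounded[OF K(1), unfolded bounded_iff] ..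
  then have R: "x \<notin> ?K" if "norm x > R" for x
    using that by (meson not_le)
  have \<psi>R: "\<psi> x = 0" if "norm x > R" for x
    by (rule \<psi>0[OF R[OF that]])
  have g0: "grad \<psi> x = 0" if "x \<notin> ?K" for x
    by (rule grad_eq_0_off_support[OF closed_closure _ that]) (rule \<psi>0)
  have gc: "continuous_on UNIV (grad \<psi>)"
    by (rule smooth_continuous_grad[OF sm])
  have gi: "integrable lborel (grad \<psi>)"
    by (rule compact_support_integrable[OF gc, of R]) (rule g0[OF R])
  have [measurable]: "grad \<psi> \<in> borel_measurable borel"
    using gc by (rule borel_measurable_continuous_onI)
  have gm: "(\<lambda>x. grad \<psi> x $ i) \<in> borel_measurable borel"
    by (rule borel_measurable_component) measurable
  have g\<Omega>: "grad \<psi> x = 0" if "x \<notin> \<Omega>" for x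
    by (rule g0) (use K(2) that in blast)
  have im: "(indicator \<Omega> :: _ \<Rightarrow> real) \<in> borel_measurable borel"
    using op by (intro borel_measurable_indicator) auto
  have "(LINT x|lebesgue_on \<Omega>. frechet_derivative \<psi> (at x) (axis i 1)) = (LINT x|lebesgue_on \<Omega>. 1 * (grad \<psi> x $ i))"
    by (simp add: grad_def)
  also have "\<dots> = (LINT x|lborel. indicator \<Omega> x * (grad \<psi> x $ i))"
    by (rule integral_representative[OF op _ im gm]) auto
  also have "(\<lambda>x. indicator \<Omega> x * (grad \<psi> x $ i)) = (\<lambda>x. grad \<psi> x \<bullet> axis i 1)"
    using g\<Omega> by (auto simp: fun_eq_iff indicator_def inner_axis)
  also have "(LINT x|lborel. grad \<psi> x \<bullet> axis i 1) = (LINT x|lborel. grad \<psi> x) \<bullet> axis i 1"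
    by (rule integral_inner_left) (rule gi)
  also have "\<dots> = 0"
    using integral_grad_compact_support[OF sm \<psi>R] by simp
  finally show ?thesis .
qed

lemma constant_weak_neumann_solution:
  fixes \<Omega> :: "(real^'n) set"
  assumes \<Omega>: "smooth_bounded_domain \<Omega>" and F: "F c = 0" and w: "AE x in lebesgue_on \<Omega>. w x = c"
  shows "weak_neumann_solution \<Omega> d F w"
proof -
  have op: "open \<Omega>" and bd: "bounded \<Omega>"
    using \<Omega> by (auto simp: smooth_bounded_domain_def)
  have S: "\<Omega> \<in> sets lebesgue" using op by (simp add: lborelD)
  have wm: "w \<in> borel_measurable (lebesgue_on \<Omega>)"
  proof -
    have "AE x in lebesgue. x \<in> \<Omega> \<longrightarrow> w x = c"
      using w S by (subst (asm) AE_restrict_space_iff) auto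
    then have "AE x in lebesgue. indicator \<Omega> x * c = indicator \<Omega> x * w x"
      by eventually_elim (auto simp: indicator_def)
    moreover have "(\<lambda>x. indicator \<Omega> x * c) \<in> borel_measurable lebesgue"
      using S by (intro borel_measurable_times borel_measurable_indicator) auto
    ultimately have "(\<lambda>x. indicator \<Omega> x * w x) \<in> borel_measurable lebesgue"
      by (rule borel_measurable_AE[rotated])
    then show ?thesis
      using S by (subst borel_measurable_restrict_space_iff) auto
  qed
  note fin = integrable_const_lebesgue_on[OF op bd]
  have "integrable (lebesgue_on \<Omega>) (\<lambda>x. (norm (w x))\<^sup>2)"
    by (rule integrable_cong_AE_imp[OF fin[of "c\<^sup>2"]]) (use wm w in \<open>auto elim: eventually_mono\<close>)
  then have "in_L2 \<Omega> w" using wm by (simp add: in_L2_def)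
  moreover have "in_L2 \<Omega> (\<lambda>x. 0 :: real^'n)" by (simp add: in_L2_def)
  moreover have "has_weak_gradient \<Omega> w (\<lambda>x. 0)"
    unfolding has_weak_gradient_def
  proof (intro allI impI)
    fix \<psi> :: "real^'n \<Rightarrow> real" and i assume \<psi>: "test_function \<Omega> \<psi>"
    let ?D = "\<lambda>x. frechet_derivative \<psi> (at x) (axis i 1)"
    have "continuous_on \<Omega> (\<lambda>x. grad \<psi> x $ i)"
      using continuous_on_subset[OF smooth_continuous_grad subset_UNIV] \<psi>
      by (intro continuous_on_component) (auto simp: test_function_def)
    then have D[measurable]: "?D \<in> borel_measurable (lebesgue_on \<Omega>)"
      using S by (intro continuous_imp_measurable_on_sets_lebesgue) (auto simp: grad_def)
    note wm[measurable]
    have "(LINT x|lebesgue_on \<Omega>. w x * ?D x) = (LINT x|lebesgue_on \<Omega>. c * ?D x)"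
    proof (rule integral_cong_AE)
      show "AE x in lebesgue_on \<Omega>. w x * ?D x = c * ?D x"
        using w by eventually_elim simp
    qed measurable
    also have "\<dots> = 0"
      using integral_test_function_derivative[OF op \<psi>] by simp
    finally show "(LINT x|lebesgue_on \<Omega>. w x * ?D x) = - (LINT x|lebesgue_on \<Omega>. (0 :: real^'n) $ i * \<psi> x)"
      by simp
  qed
  ultimately have "H1_gradient \<Omega> w (\<lambda>x. 0)" by (simp add: H1_gradient_def)
  moreover have "(LINT x|lebesgue_on \<Omega>. F (w x) * \<phi> x) = 0" for \<phi>
    by (rule integral_eq_zero_AE) (use w F in \<open>auto elim: eventually_mono\<close>)
  ultimately show ?thesis
    unfolding weak_neumann_solution_def by (intro exI[of _ "\<lambda>x. 0"]) simp
qed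

section \<open>The segregated competition problem\<close>

text \<open>On \<open>t > 0\<close> the reaction term is a positive multiple of \<open>t (\<delta> a1 / b1 - t)\<close>, and it vanishes elsewhere.\<close>

lemma f_react_sign:
  assumes "\<delta> > 0" "b1 > 0"
  shows "f_react a1 b1 c1 (pos_part t / \<delta>) (neg_part t / \<gamma>) * (arctan t - arctan (\<delta> * a1 / b1)) \<le> 0"
proof (cases "t > 0")
  case False
  then show ?thesis by (simp add: f_react_def pos_part_def)
next
  case True
  have eq: "f_react a1 b1 c1 (pos_part t / \<delta>) (neg_part t / \<gamma>) = (t / \<delta>) * (a1 - b1 * t / \<delta>)"
    using True by (simp add: f_react_def pos_part_def neg_part_def)
  show ?thesis
  proof (cases "t \<le> \<delta> * a1 / b1")
    case le: True
    then have "a1 - b1 * t / \<delta> \<ge> 0"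
      using assms by (simp add: field_simps)
    then have "(t / \<delta>) * (a1 - b1 * t / \<delta>) \<ge> 0" using True assms by simp
    moreover have "arctan t - arctan (\<delta> * a1 / b1) \<le> 0"
      using le arctan_le_iff[of t "\<delta> * a1 / b1"] by linarith
    ultimately show ?thesis
      unfolding eq by (rule mult_nonneg_nonpos)
  next
    case gt: False
    then have "a1 - b1 * t / \<delta> \<le> 0"
      using assms by (simp add: field_simps)
    then have "(t / \<delta>) * (a1 - b1 * t / \<delta>) \<le> 0"
      using True assms by (intro mult_nonneg_nonpos) auto
    moreover have "arctan t - arctan (\<delta> * a1 / b1) \<ge> 0"
      using gt arctan_le_iff[of "\<delta> * a1 / b1" t] by linarith
    ultimately show ?thesis
      unfolding eq by (rule mult_nonpos_nonneg)
  qed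
qed

text \<open>On \<open>t < 0\<close> the reaction term is a positive multiple of \<open>- t (t + \<gamma> a2 / c2)\<close>, and it vanishes elsewhere.\<close>

lemma g_react_sign:
  assumes "\<gamma> > 0" "c2 > 0"
  shows "g_react a2 b2 c2 (pos_part t / \<delta>) (neg_part t / \<gamma>) * (arctan t - arctan (- \<gamma> * a2 / c2)) \<ge> 0"
proof (cases "t < 0")
  case False
  then show ?thesis by (simp add: g_react_def neg_part_def)
next
  case True
  have eq: "g_react a2 b2 c2 (pos_part t / \<delta>) (neg_part t / \<gamma>) = (- t / \<gamma>) * (a2 + c2 * t / \<gamma>)"
    using True by (simp add: g_react_def pos_part_def neg_part_def)
  have pos: "- t / \<gamma> \<ge> 0" using True assms by (simp add: divide_nonpos_pos)
  show ?thesis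
  proof (cases "t \<ge> - \<gamma> * a2 / c2")
    case ge: True
    then have "a2 + c2 * t / \<gamma> \<ge> 0"
      using assms by (simp add: field_simps)
    then have "(- t / \<gamma>) * (a2 + c2 * t / \<gamma>) \<ge> 0" using pos by (rule mult_nonneg_nonneg[rotated])
    moreover have "arctan t - arctan (- \<gamma> * a2 / c2) \<ge> 0"
      using ge arctan_le_iff[of "- \<gamma> * a2 / c2" t] by linarith
    ultimately show ?thesis
      unfolding eq by (rule mult_nonneg_nonneg)
  next
    case lt: False
    then have "a2 + c2 * t / \<gamma> \<le> 0"
      using assms by (simp add: field_simps)
    with pos have "(- t / \<gamma>) * (a2 + c2 * t / \<gamma>) \<le> 0" by (rule mult_nonneg_nonpos)
    moreover have "arctan t - arctan (- \<gamma> * a2 / c2) \<le> 0"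
      using lt arctan_le_iff[of t "- \<gamma> * a2 / c2"] by linarith
    ultimately show ?thesis
      unfolding eq by (rule mult_nonpos_nonpos)
  qed
qed

lemma reaction_zeros:
  assumes "\<gamma> > 0" "\<delta> > 0" "b1 > 0" "c2 > 0"
    and z: "f_react a1 b1 c1 (pos_part t / \<delta>) (neg_part t / \<gamma>) = 0"
      "g_react a2 b2 c2 (pos_part t / \<delta>) (neg_part t / \<gamma>) = 0"
  shows "t \<in> {\<delta> * a1 / b1, 0, - \<gamma> * a2 / c2}"
proof -
  consider "t = 0" | "t > 0" | "t < 0" by linarith
  then show ?thesis
  proof cases
    case 2
    then have "a1 - b1 * (t / \<delta>) = 0"
      using z assms by (simp add: f_react_def pos_part_def neg_part_def)
    then show ?thesis using assms by (simp add: field_simps)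
  next
    case 3
    then have "a2 - c2 * (- t / \<gamma>) = 0"
      using z assms by (simp add: g_react_def pos_part_def neg_part_def)
    then show ?thesis using assms by (simp add: field_simps)
  qed simp
qed

lemma reaction_at_equilibria:
  assumes "\<gamma> > 0" "\<delta> > 0" "a1 > 0" "a2 > 0" "b1 > 0" "c2 > 0" and t: "t \<in> {\<delta> * a1 / b1, 0, - \<gamma> * a2 / c2}"
  shows "f_react a1 b1 c1 (pos_part t / \<delta>) (neg_part t / \<gamma>) = 0"
    and "g_react a2 b2 c2 (pos_part t / \<delta>) (neg_part t / \<gamma>) = 0"
proof -
  have "\<delta> * a1 / b1 > 0" "- \<gamma> * a2 / c2 < 0" using assms by auto
  then have p: "pos_part (\<delta> * a1 / b1) = \<delta> * a1 / b1" "neg_part (\<delta> * a1 / b1) = 0"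
    "pos_part (- \<gamma> * a2 / c2) = 0" "neg_part (- \<gamma> * a2 / c2) = \<gamma> * a2 / c2" "pos_part 0 = 0" "neg_part 0 = 0"
    by (simp_all add: pos_part_def neg_part_def)
  show "f_react a1 b1 c1 (pos_part t / \<delta>) (neg_part t / \<gamma>) = 0"
    "g_react a2 b2 c2 (pos_part t / \<delta>) (neg_part t / \<gamma>) = 0"
    using t assms by (auto simp only: insert_iff empty_iff p) (auto simp: f_react_def g_react_def)
qed

text \<open>Since the positive and the negative part never overlap, the mixed terms vanish and the growth is quadratic.\<close>

lemma reaction_integrable:
  assumes "\<And>k::real. integrable M (\<lambda>x. k)" "w \<in> borel_measurable M" "integrable M (\<lambda>x. (w x)\<^sup>2)"
  shows "integrable M (\<lambda>x. f_react a1 b1 c1 (pos_part (w x) / \<delta>) (neg_part (w x) / \<gamma>))"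
    and "integrable M (\<lambda>x. g_react a2 b2 c2 (pos_part (w x) / \<delta>) (neg_part (w x) / \<gamma>))"
proof -
  note [measurable] = assms(2)
  have i: "integrable M (\<lambda>x. 1 + (w x)\<^sup>2)" using assms(1)[of 1] assms(3) by simp
  have [measurable]: "(\<lambda>x. pos_part (w x)) \<in> borel_measurable M" "(\<lambda>x. neg_part (w x)) \<in> borel_measurable M"
    unfolding pos_part_def neg_part_def by measurable
  have bound: "norm (pos_part t) \<le> norm (1 + t\<^sup>2)" "norm (neg_part t) \<le> norm (1 + t\<^sup>2)" for t
    using abs_le_one_plus_square[of t] by (auto simp: pos_part_def neg_part_def max_def min_def abs_if split: if_splits)
  have p: "integrable M (\<lambda>x. pos_part (w x))"
    by (rule Bochner_Integration.integrable_bound[OF i _ AE_I2[OF bound(1)]]) measurable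
  have n: "integrable M (\<lambda>x. neg_part (w x))"
    by (rule Bochner_Integration.integrable_bound[OF i _ AE_I2[OF bound(2)]]) measurable
  have p2: "integrable M (\<lambda>x. (pos_part (w x))\<^sup>2)"
    by (rule Bochner_Integration.integrable_bound[OF assms(3)]) (auto simp: pos_part_def max_def)
  have n2: "integrable M (\<lambda>x. (neg_part (w x))\<^sup>2)"
    by (rule Bochner_Integration.integrable_bound[OF assms(3)]) (auto simp: neg_part_def min_def)
  have z: "pos_part t * neg_part t = 0" for t
    by (simp add: pos_part_def neg_part_def max_def min_def)
  have "f_react a1 b1 c1 (pos_part t / \<delta>) (neg_part t / \<gamma>) = (a1 / \<delta>) * pos_part t - (b1 / \<delta>\<^sup>2) * (pos_part t)\<^sup>2" for t
    using z[of t] by (auto simp: f_react_def power2_eq_square algebra_simps)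
  then show "integrable M (\<lambda>x. f_react a1 b1 c1 (pos_part (w x) / \<delta>) (neg_part (w x) / \<gamma>))"
    using p p2 by simp
  have "g_react a2 b2 c2 (pos_part t / \<delta>) (neg_part t / \<gamma>) = (a2 / \<gamma>) * neg_part t - (c2 / \<gamma>\<^sup>2) * (neg_part t)\<^sup>2" for t
    using z[of t] by (auto simp: g_react_def power2_eq_square algebra_simps)
  then show "integrable M (\<lambda>x. g_react a2 b2 c2 (pos_part (w x) / \<delta>) (neg_part (w x) / \<gamma>))"
    using n n2 by simp
qed

text \<open>The function \<open>H\<close> is the integrand of the tested equation plus multiples of \<open>f(w)\<close> and \<open>g(w)\<close>, which
  have integral zero. The multiples are chosen such that \<open>H\<close> dominates \<open>d |W|\<^sup>2 / (1 + w\<^sup>2)\<close> pointwise. As the integral of \<open>H\<close>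
  is zero, both vanish almost everywhere.\<close>

lemma weak_solution_constant:
  fixes \<Omega> :: "(real^'n) set"
  assumes \<Omega>: "smooth_bounded_domain \<Omega>"
    and pos: "d > 0" "\<gamma> > 0" "\<delta> > 0" "a1 > 0" "a2 > 0" "b1 > 0" "c2 > 0"
    and ws: "weak_neumann_solution \<Omega> d
             (\<lambda>t. f_react a1 b1 c1 (pos_part t / \<delta>) (neg_part t / \<gamma>)
                  - \<gamma> * g_react a2 b2 c2 (pos_part t / \<delta>) (neg_part t / \<gamma>)) w"
    and f0: "(LINT x|lebesgue_on \<Omega>. f_react a1 b1 c1 (pos_part (w x) / \<delta>) (neg_part (w x) / \<gamma>)) = 0"
  shows "\<exists>c \<in> {\<delta> * a1 / b1, 0, - \<gamma> * a2 / c2}. AE x in lebesgue_on \<Omega>. w x = c"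
proof -
  define M where "M = lebesgue_on \<Omega>"
  define f where "f = (\<lambda>t. f_react a1 b1 c1 (pos_part t / \<delta>) (neg_part t / \<gamma>))"
  define g where "g = (\<lambda>t. g_react a2 b2 c2 (pos_part t / \<delta>) (neg_part t / \<gamma>))"
  define F where "F = (\<lambda>t. f t - \<gamma> * g t)"
  have op: "open \<Omega>" and bd: "bounded \<Omega>" and ne: "\<Omega> \<noteq> {}"
    using \<Omega> by (auto simp: smooth_bounded_domain_def)
  have S: "\<Omega> \<in> sets lebesgue" using op by (simp add: lborelD)
  have fm: "\<Omega> \<in> lmeasurable" using bd op by (simp add: lmeasurable_open)
  have fin: "integrable M (\<lambda>x. k)" for k :: real
    unfolding M_def by (rule integrable_const_lebesgue_on[OF op bd])
  have vol: "(LINT x|M. k) = k * measure lebesgue \<Omega>" "measure lebesgue \<Omega> > 0" for k :: real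
  proof -
    show "(LINT x|M. k) = k * measure lebesgue \<Omega>"
      using S by (simp add: M_def measure_restrict_space space_restrict_space)
    have "\<not> negligible \<Omega>" using open_not_negligible[OF op ne] .
    then have "measure lebesgue \<Omega> \<noteq> 0"
      using fm by (simp add: negligible_iff_measure)
    then show "measure lebesgue \<Omega> > 0"
      using measure_nonneg[of lebesgue \<Omega>] by linarith
  qed
  obtain W where H1: "H1_gradient \<Omega> w W"
    and eq: "\<And>\<phi> \<Phi>. C1_closure_gradient \<Omega> \<phi> \<Phi> \<Longrightarrow> d * (LINT x|M. W x \<bullet> \<Phi> x) = (LINT x|M. F (w x) * \<phi> x)"
    using ws unfolding weak_neumann_solution_def M_def F_def f_def g_def by blast
  have wm: "w \<in> borel_measurable M" and w2: "integrable M (\<lambda>x. (w x)\<^sup>2)"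
    using H1 by (auto simp: H1_gradient_def in_L2_def M_def)
  have fi: "integrable M (\<lambda>x. f (w x))" and gi: "integrable M (\<lambda>x. g (w x))"
    unfolding f_def g_def by (rule reaction_integrable[OF fin wm w2])+
  have Fi: "integrable M (\<lambda>x. F (w x))" unfolding F_def using fi gi by simp
  have f0': "(LINT x|M. f (w x)) = 0" using f0 by (simp add: M_def f_def)
  have "(LINT x|M. F (w x)) = 0"
    using eq[of "\<lambda>x. 1" "\<lambda>x. 0"] by (simp add: C1_closure_gradient_def)
  then have g0: "(LINT x|M. g (w x)) = 0"
    using fi gi f0' pos by (simp add: F_def)
  define X where "X = (\<lambda>x. inverse (1 + (w x)\<^sup>2) * (norm (W x))\<^sup>2)"
  have key: "integrable M (\<lambda>x. d * X x - F (w x) * arctan (w x))" "(LINT x|M. d * X x - F (w x) * arctan (w x)) = 0"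
    unfolding X_def M_def
    by (rule weak_equation_arctan[OF \<Omega> H1]; use Fi eq in \<open>simp add: M_def\<close>)+
  define H where "H = (\<lambda>x. d * X x - F (w x) * arctan (w x) + arctan (\<delta> * a1 / b1) * f (w x)
      - arctan (- \<gamma> * a2 / c2) * \<gamma> * g (w x))"
  have X0: "X x \<ge> 0" for x
    unfolding X_def by (intro mult_nonneg_nonneg) (auto intro: add_nonneg_nonneg)
  have HX: "d * X x \<le> H x" for x
  proof -
    have "f (w x) * (arctan (w x) - arctan (\<delta> * a1 / b1)) \<le> 0"
      unfolding f_def using pos by (intro f_react_sign)
    moreover have "\<gamma> * (g (w x) * (arctan (w x) - arctan (- \<gamma> * a2 / c2))) \<ge> 0"
      unfolding g_def using pos by (intro mult_nonneg_nonneg g_react_sign) auto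
    ultimately show ?thesis
      unfolding H_def F_def by (simp add: algebra_simps)
  qed
  have Hi: "integrable M H"
    unfolding H_def using key(1) fi gi by simp
  have "(LINT x|M. H x) = 0"
    unfolding H_def using key fi gi f0' g0 by simp
  moreover have H0: "H x \<ge> 0" for x
    using HX[of x] X0[of x] pos by (meson mult_nonneg_nonneg less_imp_le order_trans)
  ultimately have "AE x in M. H x = 0"
    using integral_nonneg_eq_0_iff_AE[OF Hi] by simp
  then have "AE x in M. W x = 0"
  proof eventually_elim
    case (elim x)
    then have "d * X x \<le> 0" using HX[of x] by simp
    then have "X x = 0" using X0[of x] pos by (simp add: mult_le_0_iff)
    moreover have "1 + (w x)\<^sup>2 \<noteq> 0" using zero_le_power2[of "w x"] by linarith
    ultimately show ?case by (simp add: X_def)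
  qed
  then obtain c where c: "AE x in M. w x = c"
    using zero_gradient_imp_constant[OF \<Omega> H1] unfolding M_def by blast
  have val: "h c = 0" if "integrable M (\<lambda>x. h (w x))" "(LINT x|M. h (w x)) = 0" for h :: "real \<Rightarrow> real"
  proof -
    have "(LINT x|M. h (w x)) = (LINT x|M. h c)"
      by (rule integral_cong_AE) (use that c in \<open>auto elim: eventually_mono\<close>)
    then have "h c * measure lebesgue \<Omega> = 0"
      using that(2) vol(1)[of "h c"] by linarith
    then show ?thesis using vol(2) by simp
  qed
  have "f c = 0" "g c = 0" using val fi gi f0' g0 by auto
  then have "c \<in> {\<delta> * a1 / b1, 0, - \<gamma> * a2 / c2}"
    unfolding f_def g_def by (rule reaction_zeros[OF pos(2,3,6,7)])
  then show ?thesis using c unfolding M_def by blast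
qed

theorem proposition2p2:
  fixes \<Omega> :: "(real^'n) set"
    and d \<gamma> \<delta> a1 a2 b1 b2 c1 c2 :: real
  assumes "smooth_bounded_domain \<Omega>"
    and "d > 0" "\<gamma> > 0" "\<delta> > 0"
    and "a1 > 0" "a2 > 0" "b1 > 0" "b2 > 0" "c1 > 0" "c2 > 0"
  shows "{w :: real^'n \<Rightarrow> real.
           weak_neumann_solution \<Omega> d
             (\<lambda>t. f_react a1 b1 c1 (pos_part t / \<delta>) (neg_part t / \<gamma>)
                  - \<gamma> * g_react a2 b2 c2 (pos_part t / \<delta>) (neg_part t / \<gamma>)) w
           \<and> (LINT x|lebesgue_on \<Omega>.
                f_react a1 b1 c1 (pos_part (w x) / \<delta>) (neg_part (w x) / \<gamma>)) = 0}
         = {w. \<exists>c \<in> {\<delta> * a1 / b1, 0, - \<gamma> * a2 / c2}. AE x in lebesgue_on \<Omega>. w x = c}"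
proof (intro Set.equalityI subsetI CollectI; elim CollectE)
  fix w :: "real^'n \<Rightarrow> real"
  assume *: "weak_neumann_solution \<Omega> d
             (\<lambda>t. f_react a1 b1 c1 (pos_part t / \<delta>) (neg_part t / \<gamma>)
                  - \<gamma> * g_react a2 b2 c2 (pos_part t / \<delta>) (neg_part t / \<gamma>)) w
           \<and> (LINT x|lebesgue_on \<Omega>.
                f_react a1 b1 c1 (pos_part (w x) / \<delta>) (neg_part (w x) / \<gamma>)) = 0"
  show "\<exists>c \<in> {\<delta> * a1 / b1, 0, - \<gamma> * a2 / c2}. AE x in lebesgue_on \<Omega>. w x = c"
    by (rule weak_solution_constant[OF assms(1-7,10) conjunct1[OF *] conjunct2[OF *]])
next
  fix w :: "real^'n \<Rightarrow> real"
  assume "\<exists>c \<in> {\<delta> * a1 / b1, 0, - \<gamma> * a2 / c2}. AE x in lebesgue_on \<Omega>. w x = c"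
  then obtain c where c: "c \<in> {\<delta> * a1 / b1, 0, - \<gamma> * a2 / c2}" and w: "AE x in lebesgue_on \<Omega>. w x = c"
    by blast
  have z: "f_react a1 b1 c1 (pos_part c / \<delta>) (neg_part c / \<gamma>) = 0"
    "g_react a2 b2 c2 (pos_part c / \<delta>) (neg_part c / \<gamma>) = 0"
    using reaction_at_equilibria[OF assms(3,4,5,6,7,10) c] by auto
  have "weak_neumann_solution \<Omega> d
             (\<lambda>t. f_react a1 b1 c1 (pos_part t / \<delta>) (neg_part t / \<gamma>)
                  - \<gamma> * g_react a2 b2 c2 (pos_part t / \<delta>) (neg_part t / \<gamma>)) w"
    by (rule constant_weak_neumann_solution[OF assms(1) _ w]) (simp add: z)
  moreover have "(LINT x|lebesgue_on \<Omega>. f_react a1 b1 c1 (pos_part (w x) / \<delta>) (neg_part (w x) / \<gamma>)) = 0"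
    by (rule integral_eq_zero_AE) (use w z in \<open>auto elim: eventually_mono\<close>)
  ultimately show "weak_neumann_solution \<Omega> d
             (\<lambda>t. f_react a1 b1 c1 (pos_part t / \<delta>) (neg_part t / \<gamma>)
                  - \<gamma> * g_react a2 b2 c2 (pos_part t / \<delta>) (neg_part t / \<gamma>)) w
           \<and> (LINT x|lebesgue_on \<Omega>.
                f_react a1 b1 c1 (pos_part (w x) / \<delta>) (neg_part (w x) / \<gamma>)) = 0" ..
qed

end
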